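(* Each pattern $\sigma\in\{132,213,231,312\}$ can be detected in permutations of $[n]$ by a deterministic one-pass streaming algorithm using $O(\log n)$ bits of space and $O(n)$ arithmetic operations in total.
   Context: $[n]=\{1,\dots,n\}$. A permutation $\pi$ of $[n]$ contains a pattern $\sigma=\sigma_1\sigma_2\sigma_3$ (a permutation of $\{1,2,3\}$) if there are positions $i_1<i_2<i_3$ such that for all $a,b$, $\pi_{i_a}<\pi_{i_b}$ exactly when $\sigma_a<\sigma_b$. Detecting $\sigma$ means deciding, for every permutation $\pi$ of $[n]$, whether $\pi$ contains $\sigma$. Streaming model: the input is promised to be a permutation of $[n]$ ($n$ known in advance), whose values $\pi_1,\dots,\pi_n$ arrive one at a time in this order. A deterministic one-pass algorithm updates its memory as a function of the current memory and the arriving value, and its output is a function of the final memory. Space is the number of bits of memory (so $s$ bits allow at most $2^s$ memory states). The number of arithmetic operations counts additions, subtractions, multiplications, halvings and comparisons on integers of $O(\log n)$ bits. *)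

theory Defs
  imports "HOL-Library.Landau_Symbols" "HOL-Library.FuncSet"
    "HOL-Combinatorics.Multiset_Permutations"
begin

section \<open>Pattern containment\<close>

text \<open>
  Permutations and patterns are lists in one-line notation; positions are counted from 0.
\<close>

definition contains_pattern :: "nat list \<Rightarrow> nat list \<Rightarrow> bool" where
  "contains_pattern \<pi> \<sigma> \<longleftrightarrow>
     (\<exists>i :: nat \<Rightarrow> nat.
        strict_mono_on {..<length \<sigma>} i \<and>
        (\<forall>a<length \<sigma>. i a < length \<pi>) \<and>
        (\<forall>a<length \<sigma>. \<forall>b<length \<sigma>. \<pi> ! i a < \<pi> ! i b \<longleftrightarrow> \<sigma> ! a < \<sigma> ! b))"


section \<open>Register programs\<close>

text \<open>
  An algorithm is a program over finitely many integer registers. A register is a machine word of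
  \<open>w\<close> bits (read in two's complement), where \<open>w\<close> may depend on the input length but the program
  may not.
\<close>

type_synonym reg = nat
type_synonym state = "reg \<Rightarrow> int"

definition fits :: "nat \<Rightarrow> int \<Rightarrow> bool" where
  "fits w v \<longleftrightarrow> - (2 ^ w) \<le> 2 * v \<and> 2 * v < 2 ^ w"

datatype operand = Const int | Reg reg

fun val :: "operand \<Rightarrow> state \<Rightarrow> int" where
  "val (Const c) s = c"
| "val (Reg r) s = s r"

datatype aop = Add | Sub | Mul

fun aop_val :: "aop \<Rightarrow> int \<Rightarrow> int \<Rightarrow> int" where
  "aop_val Add x y = x + y"
| "aop_val Sub x y = x - y"
| "aop_val Mul x y = x * y"

datatype cmp = Lt | Le | Eq

fun cmp_val :: "cmp \<Rightarrow> int \<Rightarrow> int \<Rightarrow> bool" where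
  "cmp_val Lt x y \<longleftrightarrow> x < y"
| "cmp_val Le x y \<longleftrightarrow> x \<le> y"
| "cmp_val Eq x y \<longleftrightarrow> x = y"

datatype com =
    Skip
  | Move reg operand
  | Arith aop reg operand operand
  | Halve reg operand
  | Seq com com
  | Cond cmp operand operand com com
  | While cmp operand operand com

fun op_regs :: "operand \<Rightarrow> reg set" where
  "op_regs (Const c) = {}"
| "op_regs (Reg r) = {r}"

fun com_regs :: "com \<Rightarrow> reg set" where
  "com_regs Skip = {}"
| "com_regs (Move r x) = {r} \<union> op_regs x"
| "com_regs (Arith f r x y) = {r} \<union> op_regs x \<union> op_regs y"
| "com_regs (Halve r x) = {r} \<union> op_regs x"
| "com_regs (Seq c1 c2) = com_regs c1 \<union> com_regs c2"
| "com_regs (Cond p x y c1 c2) = op_regs x \<union> op_regs y \<union> com_regs c1 \<union> com_regs c2"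
| "com_regs (While p x y c) = op_regs x \<union> op_regs y \<union> com_regs c"

text \<open>
  \<open>exec w c s t m\<close>: with \<open>w\<close>-bit words, \<open>c\<close> terminates from \<open>s\<close> in \<open>t\<close> after exactly \<open>m\<close>
  additions, subtractions, multiplications, halvings and comparisons. A command that would store
  a value that does not fit into a word has no execution, so an execution certifies that every
  intermediate result is a \<open>w\<close>-bit integer. Odd numbers are halved downwards. Moving a value is
  not an arithmetic operation.
\<close>

inductive exec :: "nat \<Rightarrow> com \<Rightarrow> state \<Rightarrow> state \<Rightarrow> nat \<Rightarrow> bool" for w :: nat where
  exec_Skip: "exec w Skip s s 0"
| exec_Move: "fits w (val x s) \<Longrightarrow> exec w (Move r x) s (s(r := val x s)) 0"
| exec_Arith: "fits w (aop_val f (val x s) (val y s)) \<Longrightarrow>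
    exec w (Arith f r x y) s (s(r := aop_val f (val x s) (val y s))) 1"
| exec_Halve: "fits w (val x s div 2) \<Longrightarrow> exec w (Halve r x) s (s(r := val x s div 2)) 1"
| exec_Seq: "exec w c1 s t m1 \<Longrightarrow> exec w c2 t u m2 \<Longrightarrow> exec w (Seq c1 c2) s u (m1 + m2)"
| exec_CondT: "cmp_val p (val x s) (val y s) \<Longrightarrow> exec w c1 s t m \<Longrightarrow>
    exec w (Cond p x y c1 c2) s t (1 + m)"
| exec_CondF: "\<not> cmp_val p (val x s) (val y s) \<Longrightarrow> exec w c2 s t m \<Longrightarrow>
    exec w (Cond p x y c1 c2) s t (1 + m)"
| exec_WhileF: "\<not> cmp_val p (val x s) (val y s) \<Longrightarrow> exec w (While p x y c) s s 1"
| exec_WhileT: "cmp_val p (val x s) (val y s) \<Longrightarrow> exec w c s t m1 \<Longrightarrow>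
    exec w (While p x y c) t u m2 \<Longrightarrow> exec w (While p x y c) s u (1 + m1 + m2)"


section \<open>One-pass streaming algorithms\<close>

text \<open>
  Register 0 initially holds the length \<open>n\<close> of the stream, all other registers 0. Each arriving
  value is written to register 1, overwriting its contents, and then \<open>update_code\<close> is run once.
  After the last value \<open>output_code\<close> is run, and the answer is "yes" iff register 2 is then
  nonzero.
\<close>

datatype stream_alg =
  Stream_Alg (init_code: com) (update_code: com) (output_code: com)

definition alg_regs :: "stream_alg \<Rightarrow> reg set" where
  "alg_regs A = {0, 1, 2} \<union> com_regs (init_code A) \<union> com_regs (update_code A) \<union>
     com_regs (output_code A)"

inductive exec_stream ::
  "nat \<Rightarrow> com \<Rightarrow> nat list \<Rightarrow> state \<Rightarrow> state \<Rightarrow> nat \<Rightarrow> bool" for w :: nat and c :: com where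
  exec_stream_Nil: "exec_stream w c [] s s 0"
| exec_stream_Cons: "fits w (int v) \<Longrightarrow> exec w c (s(1 := int v)) t m1 \<Longrightarrow>
    exec_stream w c vs t u m2 \<Longrightarrow> exec_stream w c (v # vs) s u (m1 + m2)"

definition run_alg :: "nat \<Rightarrow> stream_alg \<Rightarrow> nat list \<Rightarrow> bool \<Rightarrow> nat \<Rightarrow> bool" where
  "run_alg w A vs answer m \<longleftrightarrow>
     fits w (int (length vs)) \<and>
     (\<exists>s t u m1 m2 m3.
        exec w (init_code A) ((\<lambda>_. 0)(0 := int (length vs))) s m1 \<and>
        exec_stream w (update_code A) vs s t m2 \<and>
        exec w (output_code A) t u m3 \<and>
        answer = (u 2 \<noteq> 0) \<and> m = m1 + m2 + m3)"

text \<open>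
  The space counts all registers, including those used only for scratch work, the input register
  and the register holding the length.
\<close>

definition space_bits :: "stream_alg \<Rightarrow> nat \<Rightarrow> nat" where
  "space_bits A w = card (alg_regs A) * w"

text \<open>
  \<open>A\<close> decides containment of \<open>\<sigma>\<close> for the permutations of \<open>[n]\<close>, for every \<open>n\<close>, using words of
  \<open>w n\<close> bits and at most \<open>ops n\<close> arithmetic operations in total.
\<close>

definition detects :: "stream_alg \<Rightarrow> nat list \<Rightarrow> (nat \<Rightarrow> nat) \<Rightarrow> (nat \<Rightarrow> nat) \<Rightarrow> bool" where
  "detects A \<sigma> w ops \<longleftrightarrow>
     (\<forall>n. \<forall>\<pi>\<in>permutations_of_set {1..n}.
        \<exists>m\<le>ops n. run_alg (w n) A \<pi> (contains_pattern \<pi> \<sigma>) m)"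


section \<open>The model is deterministic and obeys the space bound\<close>

inductive_cases exec_SkipE: "exec w Skip s t m"
inductive_cases exec_MoveE: "exec w (Move r x) s t m"
inductive_cases exec_ArithE: "exec w (Arith f r x y) s t m"
inductive_cases exec_HalveE: "exec w (Halve r x) s t m"
inductive_cases exec_SeqE: "exec w (Seq c1 c2) s t m"
inductive_cases exec_CondE: "exec w (Cond p x y c1 c2) s t m"
inductive_cases exec_WhileE: "exec w (While p x y c) s t m"

inductive_cases exec_stream_NilE: "exec_stream w c [] s t m"
inductive_cases exec_stream_ConsE: "exec_stream w c (v # vs) s t m"

lemma exec_deterministic:
  "exec w c s t m \<Longrightarrow> exec w c s t' m' \<Longrightarrow> t' = t \<and> m' = m"
proof (induction arbitrary: t' m' rule: exec.induct)
  case exec_Skip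
  then show ?case by (elim exec_SkipE) simp
next
  case exec_Move
  from exec_Move.prems show ?case by (elim exec_MoveE) simp
next
  case exec_Arith
  from exec_Arith.prems show ?case by (elim exec_ArithE) simp
next
  case exec_Halve
  from exec_Halve.prems show ?case by (elim exec_HalveE) simp
next
  case exec_Seq
  from exec_Seq.prems show ?case
    by (rule exec_SeqE) (metis exec_Seq.IH)
next
  case exec_CondT
  from exec_CondT.prems show ?case
    by (rule exec_CondE) (use exec_CondT.hyps in \<open>auto dest!: exec_CondT.IH\<close>)
next
  case exec_CondF
  from exec_CondF.prems show ?case
    by (rule exec_CondE) (use exec_CondF.hyps in \<open>auto dest!: exec_CondF.IH\<close>)
next
  case exec_WhileF
  from exec_WhileF.prems show ?case
    by (rule exec_WhileE) (use exec_WhileF.hyps in auto)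
next
  case exec_WhileT
  from exec_WhileT.prems show ?case
    by (rule exec_WhileE) (use exec_WhileT.hyps in \<open>auto dest!: exec_WhileT.IH\<close>)
qed

lemma exec_stream_deterministic:
  "exec_stream w c vs s t m \<Longrightarrow> exec_stream w c vs s t' m' \<Longrightarrow> t' = t \<and> m' = m"
proof (induction arbitrary: t' m' rule: exec_stream.induct)
  case exec_stream_Nil
  then show ?case by (elim exec_stream_NilE) simp
next
  case exec_stream_Cons
  from exec_stream_Cons.prems show ?case
    by (rule exec_stream_ConsE)
      (use exec_stream_Cons.hyps(2) in \<open>auto dest!: exec_stream_Cons.IH dest: exec_deterministic\<close>)
qed

lemma run_alg_deterministic:
  assumes "run_alg w A vs b m" "run_alg w A vs b' m'"
  shows "b' = b \<and> m' = m"
  using assms unfolding run_alg_def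
  by (elim conjE exE) (metis exec_deterministic exec_stream_deterministic)

definition memory_states :: "nat \<Rightarrow> reg set \<Rightarrow> state set" where
  "memory_states w R = {s. (\<forall>r\<in>R. fits w (s r)) \<and> (\<forall>r. r \<notin> R \<longrightarrow> s r = 0)}"

lemma exec_memory_states:
  "exec w c s t m \<Longrightarrow> com_regs c \<subseteq> R \<Longrightarrow> s \<in> memory_states w R \<Longrightarrow> t \<in> memory_states w R"
  by (induction rule: exec.induct) (auto simp: memory_states_def)

lemma card_words: "finite {v. fits w v}" "card {v. fits w v} = 2 ^ w"
proof -
  have "{v. fits w v} = (if w = 0 then {0} else {- (2 ^ (w - 1))..<2 ^ (w - 1)})"
    by (cases w) (auto simp: fits_def)
  then show "finite {v. fits w v}" "card {v. fits w v} = 2 ^ w"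
    by (cases w; simp add: nat_power_eq nat_mult_distrib)+
qed

lemma card_memory_states:
  assumes "finite R"
  shows "card (memory_states w R) = 2 ^ (card R * w)"
proof -
  have "bij_betw (\<lambda>s. restrict s R) (memory_states w R) (R \<rightarrow>\<^sub>E {v. fits w v})"
    by (rule bij_betw_byWitness[where f' = "\<lambda>f r. if r \<in> R then f r else 0"])
       (auto simp: memory_states_def fun_eq_iff PiE_def extensional_def)
  then have "card (memory_states w R) = card (R \<rightarrow>\<^sub>E {v. fits w v})"
    by (rule bij_betw_same_card)
  then show ?thesis
    using assms by (simp add: card_PiE card_words power_mult mult.commute)
qed

end

theory Submission
  imports Defs "HOL-Real_Asymp.Real_Asymp"
begin

text \<open>
  The sum of all \<open>\<bar>\<pi>\<^sub>j - \<pi>\<^sub>i\<bar>\<close> is the same for every permutation of \<open>[n]\<close>, so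
  \<open>W = \<Sum> max(0, \<pi>\<^sub>j - \<pi>\<^sub>i)\<close> over all \<open>i < j\<close> is found in one pass from sums of the entries.

  A noninversion \<open>\<pi>\<^sub>i < \<pi>\<^sub>j\<close> completes a 312 iff \<open>\<pi>\<^sub>j\<close> is less than the maximum \<open>M\<^sub>i\<close> of the prefix
  ending at \<open>i\<close>. All values above \<open>M\<^sub>i\<close> arrive after \<open>\<pi>\<^sub>i\<close>, so the other noninversions with first
  entry \<open>\<pi>\<^sub>i\<close> contribute to \<open>W\<close> the sum of \<open>y - \<pi>\<^sub>i\<close> over all \<open>y > M\<^sub>i\<close>. Hence \<open>\<pi>\<close> avoids 312 iff
  these contributions add up to \<open>W\<close>.

  Symmetrically, a noninversion \<open>\<pi>\<^sub>i < \<pi>\<^sub>j\<close> starts a 231 iff \<open>\<pi>\<^sub>i\<close> exceeds the minimum \<open>m\<^sub>j\<close> of the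
  suffix starting at \<open>j\<close>, and the values below \<open>m\<^sub>j\<close> have all arrived before \<open>\<pi>\<^sub>j\<close>. The suffix minimum
  lies in the future, but if the last entries of the maximal descending runs fail to increase, there
  is a 231, and otherwise \<open>m\<^sub>j\<close> is the last entry of the run of \<open>\<pi>\<^sub>j\<close>; so the contributions of a run
  can be added when it ends, from its length and its sum.

  Replacing each value \<open>v\<close> by \<open>n + 1 - v\<close> turns 132 and 213 into 312 and 231.
\<close>

section \<open>Loop-free register programs\<close>

text \<open>A loop that is reached has precondition False, so a provable precondition yields the
  static cost bound \<open>max_ops\<close>. The \<open>fits\<close> conjuncts rule out overflow at
  every store.\<close>

fun wp :: "nat \<Rightarrow> com \<Rightarrow> (state \<Rightarrow> bool) \<Rightarrow> state \<Rightarrow> bool" where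
  "wp w Skip Q s \<longleftrightarrow> Q s"
| "wp w (Move r x) Q s \<longleftrightarrow> fits w (val x s) \<and> Q (s(r := val x s))"
| "wp w (Arith f r x y) Q s \<longleftrightarrow>
     fits w (aop_val f (val x s) (val y s)) \<and> Q (s(r := aop_val f (val x s) (val y s)))"
| "wp w (Halve r x) Q s \<longleftrightarrow> fits w (val x s div 2) \<and> Q (s(r := val x s div 2))"
| "wp w (Seq c1 c2) Q s \<longleftrightarrow> wp w c1 (wp w c2 Q) s"
| "wp w (Cond p x y c1 c2) Q s \<longleftrightarrow>
     (if cmp_val p (val x s) (val y s) then wp w c1 Q s else wp w c2 Q s)"
| "wp w (While p x y c) Q s \<longleftrightarrow> False"

fun max_ops :: "com \<Rightarrow> nat" where
  "max_ops Skip = 0"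
| "max_ops (Move r x) = 0"
| "max_ops (Arith f r x y) = 1"
| "max_ops (Halve r x) = 1"
| "max_ops (Seq c1 c2) = max_ops c1 + max_ops c2"
| "max_ops (Cond p x y c1 c2) = 1 + max (max_ops c1) (max_ops c2)"
| "max_ops (While p x y c) = 0"

lemma wp_exec:
  assumes "wp w c Q s"
  obtains t m where "exec w c s t m" "Q t" "m \<le> max_ops c"
proof -
  have "\<exists>t m. exec w c s t m \<and> Q t \<and> m \<le> max_ops c"
    using assms
  proof (induction c arbitrary: Q s)
    case (Seq c1 c2)
    from Seq.prems obtain t m where 1: "exec w c1 s t m" "wp w c2 Q t" "m \<le> max_ops c1"
      using Seq.IH(1) by (metis wp.simps(5))
    from Seq.IH(2)[OF 1(2)] obtain u k where "exec w c2 t u k" "Q u" "k \<le> max_ops c2"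
      by blast
    with 1 show ?case
      by (metis add_mono exec_Seq max_ops.simps(5))
  next
    case (Cond p x y c1 c2)
    show ?case
    proof (cases "cmp_val p (val x s) (val y s)")
      case True
      then obtain t m where "exec w c1 s t m" "Q t" "m \<le> max_ops c1"
        using Cond by (metis wp.simps(6))
      then show ?thesis
        using exec_CondT[OF True] by (intro exI[of _ t] exI[of _ "1 + m"]) auto
    next
      case False
      then obtain t m where "exec w c2 s t m" "Q t" "m \<le> max_ops c2"
        using Cond by (metis wp.simps(6))
      then show ?thesis
        using exec_CondF[OF False] by (intro exI[of _ t] exI[of _ "1 + m"]) auto
    qed
  next
    case Skip
    then show ?case
      by (metis exec_Skip le0 wp.simps(1))
  next
    case Move
    then show ?case
      by (metis exec_Move le0 wp.simps(2))
  next
    case Arith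
    then show ?case
      by (metis exec_Arith max_ops.simps(3) order_refl wp.simps(3))
  next
    case Halve
    then show ?case
      by (metis exec_Halve max_ops.simps(4) order_refl wp.simps(4))
  qed simp
  then show thesis
    using that by blast
qed

lemma exec_stream_invariant:
  assumes "\<And>k s. k < length vs \<Longrightarrow> I k s \<Longrightarrow> wp w c (I (Suc k)) (s(1 := int (vs ! k)))"
    and "\<And>v. v \<in> set vs \<Longrightarrow> fits w (int v)"
    and "I 0 s"
  obtains t m where "exec_stream w c vs s t m" "I (length vs) t" "m \<le> length vs * max_ops c"
proof -
  have "\<exists>t m. exec_stream w c vs s t m \<and> I (length vs) t \<and> m \<le> length vs * max_ops c"
    using assms
  proof (induction vs arbitrary: I s)
    case Nil
    then show ?case
      by (auto intro!: exec_stream_Nil)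
  next
    case (Cons v vs)
    have "wp w c (I 1) (s(1 := int v))"
      using Cons.prems(1)[of 0 s] Cons.prems(3) by (simp add: fun_upd_def)
    then obtain t m1 where t: "exec w c (s(1 := int v)) t m1" "I 1 t" "m1 \<le> max_ops c"
      by (rule wp_exec)
    \<comment> \<open>The tail is run under the invariant shifted by one.\<close>
    have "\<exists>u m. exec_stream w c vs t u m \<and> I (Suc (length vs)) u \<and> m \<le> length vs * max_ops c"
      by (rule Cons.IH[of "\<lambda>k. I (Suc k)"])
        (use Cons.prems(1)[of "Suc _"] Cons.prems(2) t(2) in auto)
    with t show ?case
      using exec_stream_Cons[OF Cons.prems(2)] by fastforce
  qed
  then show thesis
    using that by blast
qed

text \<open>The invariant is chosen after the permutation, so it may refer to the entries read and
  even to those still to come.\<close>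

lemma detectsI:
  assumes "\<And>n \<pi>. \<pi> \<in> permutations_of_set {1..n} \<Longrightarrow>
      fits (w n) (int n) \<and>
      (\<exists>I. wp (w n) c0 (I 0) ((\<lambda>_. 0)(0 := int n)) \<and>
           (\<forall>k s. k < n \<longrightarrow> I k s \<longrightarrow> wp (w n) c1 (I (Suc k)) (s(1 := int (\<pi> ! k)))) \<and>
           (\<forall>s. I n s \<longrightarrow> wp (w n) c2 (\<lambda>u. contains_pattern \<pi> \<sigma> = (u 2 \<noteq> 0)) s))"
  shows "detects (Stream_Alg c0 c1 c2) \<sigma> w (\<lambda>n. max_ops c0 + n * max_ops c1 + max_ops c2)"
  unfolding detects_def
proof (intro allI ballI)
  fix n :: nat and \<pi> :: "nat list"
  assume \<pi>: "\<pi> \<in> permutations_of_set {1..n}"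
  then have len: "length \<pi> = n" and set: "set \<pi> = {1..n}"
    by (auto dest: permutations_of_setD simp: length_finite_permutations_of_set)
  have n: "fits (w n) (int n)"
    using assms[OF \<pi>] by simp
  then have fits: "fits (w n) (int v)" if "v \<in> set \<pi>" for v
    using that set by (auto simp: fits_def intro: order_trans[of _ 0])
  obtain I where I0: "wp (w n) c0 (I (0::nat)) ((\<lambda>_. 0)(0 := int n))"
    and I1: "\<And>k s. k < n \<Longrightarrow> I k s \<Longrightarrow> wp (w n) c1 (I (Suc k)) (s(1 := int (\<pi> ! k)))"
    and I2: "\<And>s. I n s \<Longrightarrow> wp (w n) c2 (\<lambda>u. contains_pattern \<pi> \<sigma> = (u 2 \<noteq> 0)) s"
    using assms[OF \<pi>] by blast
  obtain s m0 where s: "exec (w n) c0 ((\<lambda>_. 0)(0 := int n)) s m0" "I 0 s" "m0 \<le> max_ops c0"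
    using I0 by (rule wp_exec)
  obtain t m1 where t: "exec_stream (w n) c1 \<pi> s t m1" "I n t" "m1 \<le> n * max_ops c1"
    using exec_stream_invariant[of \<pi> I "w n" c1 s] I1 s(2) fits len by metis
  obtain u m2 where u: "exec (w n) c2 t u m2" "contains_pattern \<pi> \<sigma> = (u 2 \<noteq> 0)"
      "m2 \<le> max_ops c2"
    using I2[OF t(2)] by (rule wp_exec)
  have "run_alg (w n) (Stream_Alg c0 c1 c2) \<pi> (contains_pattern \<pi> \<sigma>) (m0 + m1 + m2)"
    unfolding run_alg_def stream_alg.sel len using s(1) t(1) u(1,2) n by blast
  moreover have "m0 + m1 + m2 \<le> max_ops c0 + n * max_ops c1 + max_ops c2"
    using s(3) t(3) u(3) by linarith
  ultimately show "\<exists>m\<le>max_ops c0 + n * max_ops c1 + max_ops c2.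
      run_alg (w n) (Stream_Alg c0 c1 c2) \<pi> (contains_pattern \<pi> \<sigma>) m"
    by blast
qed

text \<open>Stored values stay below a multiple of \<open>(n + 1) ^ 4\<close>, hence four times the
  logarithm. The 12 further bits cover the constant: \<open>fits\<close> doubles the value, and 2 *
  2000 < 4096 = 2 ^ 12.\<close>

definition word_bits :: "nat \<Rightarrow> nat" where
  "word_bits n = 12 + 4 * nat \<lceil>log 2 (real n + 1)\<rceil>"

lemma fits_word_bits:
  assumes "\<bar>v\<bar> \<le> 2000 * (int n + 1) ^ 4"
  shows "fits (word_bits n) v"
proof -
  define L where "L = nat \<lceil>log 2 (real n + 1)\<rceil>"
  have "real n + 1 = 2 powr (log 2 (real n + 1))"
    by simp
  also have "\<dots> \<le> 2 powr (real L)"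
    unfolding L_def by (intro powr_mono) (auto simp: le_nat_iff real_nat_ceiling_ge)
  finally have "real_of_int (int n + 1) \<le> real_of_int (2 ^ L)"
    by (simp add: powr_realpow)
  then have "int n + 1 \<le> 2 ^ L"
    by linarith
  then have "(int n + 1) ^ 4 \<le> (2 ^ L) ^ 4"
    by (intro power_mono) auto
  then have "\<bar>v\<bar> \<le> 2000 * 2 ^ (4 * L)"
    using assms unfolding mult.commute[of 4 L] power_mult by linarith
  moreover have "(0::int) < 2 ^ (4 * L)"
    by simp
  ultimately have "- (4096 * 2 ^ (4 * L)) \<le> 2 * v" "2 * v < 4096 * 2 ^ (4 * L)"
    by linarith+
  then show ?thesis
    unfolding fits_def word_bits_def L_def[symmetric] by (simp add: power_add)
qed

lemma word_bits_bigo: "(\<lambda>n. real (c * word_bits n)) \<in> O(\<lambda>n. ln (real n))"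
proof -
  have *: "real (word_bits n) \<le> 12 + 4 * (log 2 (real n + 1) + 1)" for n
  proof -
    have "0 \<le> log 2 (real n + 1)"
      by simp
    then show ?thesis
      using mult_left_mono[OF of_int_ceiling_le_add_one[of "log 2 (real n + 1)"], of 4]
      unfolding word_bits_def by (simp add: of_nat_nat distrib_left)
  qed
  have "(\<lambda>n. real (word_bits n)) \<in> O(\<lambda>n. 12 + 4 * (log 2 (real n + 1) + 1))"
  proof (rule bigoI[of _ 1], rule always_eventually, rule allI)
    fix n
    show "norm (real (word_bits n)) \<le> 1 * norm (12 + 4 * (log 2 (real n + 1) + 1))"
      unfolding real_norm_def mult_1 abs_of_nat using *[of n] abs_ge_self by (rule order_trans)
  qed
  also have "(\<lambda>n. 12 + 4 * (log 2 (real n + 1) + 1)) \<in> O(\<lambda>n::nat. ln (real n))"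
    by real_asymp
  finally show ?thesis
    by simp
qed

section \<open>Weighted noninversions\<close>

lemma contains_pattern_3:
  "contains_pattern \<pi> [p, q, r] \<longleftrightarrow>
     (\<exists>i j k. i < j \<and> j < k \<and> k < length \<pi> \<and>
        (\<pi> ! i < \<pi> ! j \<longleftrightarrow> p < q) \<and> (\<pi> ! j < \<pi> ! i \<longleftrightarrow> q < p) \<and>
        (\<pi> ! i < \<pi> ! k \<longleftrightarrow> p < r) \<and> (\<pi> ! k < \<pi> ! i \<longleftrightarrow> r < p) \<and>
        (\<pi> ! j < \<pi> ! k \<longleftrightarrow> q < r) \<and> (\<pi> ! k < \<pi> ! j \<longleftrightarrow> r < q))"
    (is "_ \<longleftrightarrow> ?R")
proof
  assume "contains_pattern \<pi> [p, q, r]"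
  then obtain i where mono: "strict_mono_on {..<3} i"
    and bound: "\<And>a. a < 3 \<Longrightarrow> i a < length \<pi>"
    and iff: "\<And>a b. a < 3 \<Longrightarrow> b < 3 \<Longrightarrow> \<pi> ! i a < \<pi> ! i b \<longleftrightarrow> [p, q, r] ! a < [p, q, r] ! b"
    unfolding contains_pattern_def by (auto simp: numeral_3_eq_3)
  have "i 0 < i 1" "i 1 < i 2"
    using strict_mono_onD[OF mono, of 0 1] strict_mono_onD[OF mono, of 1 2] by auto
  then show ?R
    using bound[of 2] iff[of 0 1] iff[of 1 0] iff[of 0 2] iff[of 2 0] iff[of 1 2] iff[of 2 1]
    by (intro exI[of _ "i 0"] exI[of _ "i 1"] exI[of _ "i 2"]) simp
next
  assume ?R
  then obtain i j k where *: "i < j" "j < k" "k < length \<pi>"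
    "\<pi> ! i < \<pi> ! j \<longleftrightarrow> p < q" "\<pi> ! j < \<pi> ! i \<longleftrightarrow> q < p"
    "\<pi> ! i < \<pi> ! k \<longleftrightarrow> p < r" "\<pi> ! k < \<pi> ! i \<longleftrightarrow> r < p"
    "\<pi> ! j < \<pi> ! k \<longleftrightarrow> q < r" "\<pi> ! k < \<pi> ! j \<longleftrightarrow> r < q"
    by blast
  show "contains_pattern \<pi> [p, q, r]"
    unfolding contains_pattern_def
    by (rule exI[of _ "(!) [i, j, k]"])
      (use * in \<open>auto simp: strict_mono_on_def less_Suc_eq\<close>)
qed

text \<open>Two inequalities suffice, as the third comparison follows by transitivity. Integer
  entries make room for the complements \<open>c - v\<close>.\<close>

definition has_312 :: "int list \<Rightarrow> bool" where
  "has_312 xs \<longleftrightarrow>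
     (\<exists>i j k. i < j \<and> j < k \<and> k < length xs \<and> xs ! j < xs ! k \<and> xs ! k < xs ! i)"

definition has_231 :: "int list \<Rightarrow> bool" where
  "has_231 xs \<longleftrightarrow>
     (\<exists>i j k. i < j \<and> j < k \<and> k < length xs \<and> xs ! k < xs ! i \<and> xs ! i < xs ! j)"

lemma contains_312_iff: "contains_pattern \<pi> [3, 1, 2] \<longleftrightarrow> has_312 (map int \<pi>)"
  unfolding contains_pattern_3 has_312_def length_map
  by (intro iff_exI) auto

text \<open>Any \<open>c\<close> reverses all comparisons; the later choice \<open>n + 1\<close>
  also keeps the values between 1 and \<open>n\<close>.\<close>

lemma contains_132_iff:
  "contains_pattern \<pi> [1, 3, 2] \<longleftrightarrow> has_312 (map (\<lambda>v. c - int v) \<pi>)"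
  unfolding contains_pattern_3 has_312_def length_map
  by (intro iff_exI) auto

lemma contains_231_iff: "contains_pattern \<pi> [2, 3, 1] \<longleftrightarrow> has_231 (map int \<pi>)"
  unfolding contains_pattern_3 has_231_def length_map
  by (intro iff_exI) auto

lemma contains_213_iff:
  "contains_pattern \<pi> [2, 1, 3] \<longleftrightarrow> has_231 (map (\<lambda>v. c - int v) \<pi>)"
  unfolding contains_pattern_3 has_231_def length_map
  by (intro iff_exI) auto

section \<open>Closed forms for the weighted noninversion sum\<close>

lemma sum_symmetric_square:
  fixes g :: "nat \<Rightarrow> nat \<Rightarrow> int"
  assumes "\<And>i j. g i j = g j i" "\<And>i. g i i = 0"
  shows "(\<Sum>j<n. \<Sum>i<n. g i j) = 2 * (\<Sum>j<n. \<Sum>i<j. g i j)"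
proof (induction n)
  case (Suc n)
  have "(\<Sum>j<Suc n. \<Sum>i<Suc n. g i j) = (\<Sum>j<n. \<Sum>i<n. g i j) + (\<Sum>j<n. g n j) + (\<Sum>i<n. g i n)"
    by (simp add: sum.distrib assms(2))
  also have "(\<Sum>j<n. g n j) = (\<Sum>i<n. g i n)"
    using assms(1) by (intro sum.cong) auto
  finally show ?case
    using Suc by simp
qed simp

text \<open>An arithmetic series, doubled to avoid a division.\<close>

lemma sum_below:
  fixes m x :: int
  assumes "1 \<le> m"
  shows "2 * (\<Sum>s\<in>{1..<m}. x - s) = (m - 1) * (2 * x - m)"
  using assms
proof (induction m rule: int_ge_induct)
  case (step m)
  then have "{1..<m + 1} = insert m {1..<m}"
    by auto
  with step show ?case
    by (simp add: algebra_simps)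
qed simp

text \<open>In the induction step the new largest value has distances 1 to \<open>n\<close> from the
  others; counting both orders doubles their sum n (n + 1) / 2 to the new summand.\<close>

lemma sum_abs_diff_interval:
  "(\<Sum>a\<in>{1..int n}. \<Sum>b\<in>{1..int n}. \<bar>a - b\<bar>) = (\<Sum>a\<in>{1..int n}. a * (a - 1))"
proof (induction n)
  case (Suc n)
  have *: "{1..int (Suc n)} = insert (int (Suc n)) {1..int n}"
    by auto
  have "(\<Sum>b\<in>{1..int n}. \<bar>int (Suc n) - b\<bar>) = (\<Sum>b\<in>{1..<int (Suc n)}. int (Suc n) - b)"
    by (intro sum.cong) auto
  then have "2 * (\<Sum>b\<in>{1..int n}. \<bar>int (Suc n) - b\<bar>) = int (Suc n) * (int (Suc n) - 1)"
    using sum_below[of "int (Suc n)" "int (Suc n)"] by (simp add: algebra_simps)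
  moreover have "(\<Sum>b\<in>{1..int n}. \<bar>b - int (Suc n)\<bar>) = (\<Sum>b\<in>{1..int n}. \<bar>int (Suc n) - b\<bar>)"
    by (intro sum.cong) auto
  ultimately show ?case
    using Suc unfolding * by (simp add: sum.distrib)
qed simp

lemma sum_nth_permutation:
  assumes "distinct xs" "set xs = {1..int n}" "length xs = n"
  shows "(\<Sum>i<n. f (xs ! i)) = (\<Sum>a\<in>{1..int n}. f a)"
  using assms by (intro sum.reindex_bij_betw bij_betw_nth) auto

text \<open>
  The sum of all \<open>\<bar>x\<^sub>j - x\<^sub>i\<bar>\<close> does not depend on the order of the entries, and
  \<open>2 max(0, d) = \<bar>d\<bar> + d\<close>.
\<close>

lemma sum_noninversions:
  assumes "distinct xs" "set xs = {1..int n}" "length xs = n"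
  shows "4 * (\<Sum>j<n. \<Sum>i<j. max 0 (xs ! j - xs ! i)) =
    (\<Sum>j<n. xs ! j * (xs ! j - 1) + 2 * (\<Sum>i<j. xs ! j - xs ! i))"
proof -
  have "2 * (\<Sum>j<n. \<Sum>i<j. \<bar>xs ! j - xs ! i\<bar>) = (\<Sum>j<n. \<Sum>i<n. \<bar>xs ! j - xs ! i\<bar>)"
    by (rule sum_symmetric_square[symmetric]) auto
  also have "\<dots> = (\<Sum>j<n. \<Sum>b\<in>{1..int n}. \<bar>xs ! j - b\<bar>)"
    by (intro sum.cong refl sum_nth_permutation assms)
  also have "\<dots> = (\<Sum>a\<in>{1..int n}. \<Sum>b\<in>{1..int n}. \<bar>a - b\<bar>)"
    by (rule sum_nth_permutation[OF assms])
  also have "\<dots> = (\<Sum>j<n. xs ! j * (xs ! j - 1))"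
    unfolding sum_abs_diff_interval by (rule sum_nth_permutation[OF assms, symmetric])
  finally have "2 * (\<Sum>j<n. \<Sum>i<j. \<bar>xs ! j - xs ! i\<bar>) = \<dots>" .
  moreover have "2 * (\<Sum>j<n. \<Sum>i<j. max 0 (xs ! j - xs ! i)) =
      (\<Sum>j<n. \<Sum>i<j. \<bar>xs ! j - xs ! i\<bar>) + (\<Sum>j<n. \<Sum>i<j. xs ! j - xs ! i)"
    unfolding sum_distrib_left sum.distrib[symmetric] by (intro sum.cong) (auto simp: max_def)
  \<comment> \<open>The factor 4 joins two doublings: one from ordered pairs, one from
    \<open>2 * max 0 d\<close>.\<close>
  ultimately show ?thesis
    by (simp add: sum.distrib sum_distrib_left[symmetric])
qed

lemma sum_above:
  fixes M n x :: int
  assumes "M \<le> n"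
  shows "2 * (\<Sum>y\<in>{M<..n}. y - x) = (n - M) * (n + M + 1 - 2 * x)"
  using assms
proof (induction n rule: int_ge_induct)
  case (step n)
  then have "{M<..n + 1} = insert (n + 1) {M<..n}"
    by auto
  with step show ?case
    by (simp add: algebra_simps)
qed simp

text \<open>The inner sum is expressed by a prefix sum, so that the term is computable when entry
  \<open>j\<close> arrives. Only the total over all \<open>j\<close> is four times the weighted
  noninversion sum; single terms need not match.\<close>

definition weight :: "int list \<Rightarrow> nat \<Rightarrow> int" where
  "weight xs j = xs ! j * (xs ! j - 1) + 2 * (int j * xs ! j - sum_list (take j xs))"

text \<open>By \<open>sum_above\<close> this is four times the sum of \<open>y - x\<close> over the
  values \<open>y\<close> from \<open>M + 1\<close> to \<open>n\<close>, if
  \<open>M \<le> n\<close>.\<close>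

definition above_sum :: "int \<Rightarrow> int \<Rightarrow> int \<Rightarrow> int" where
  "above_sum n M x = 2 * ((n - M) * (n + M + 1 - 2 * x))"

text \<open>\<open>r\<close> entries with sum \<open>X\<close> are treated at once.\<close>

definition below_sum :: "int \<Rightarrow> int \<Rightarrow> int \<Rightarrow> int" where
  "below_sum m r X = 2 * ((m - 1) * (2 * X - r * m))"

lemma sum_weight:
  assumes "distinct xs" "set xs = {1..int n}" "length xs = n"
  shows "(\<Sum>j<n. weight xs j) = 4 * (\<Sum>j<n. \<Sum>i<j. max 0 (xs ! j - xs ! i))"
  unfolding sum_noninversions[OF assms]
proof (rule sum.cong[OF refl])
  fix j assume "j \<in> {..<n}"
  then have "sum_list (take j xs) = (\<Sum>i<j. xs ! i)"
    using assms(3) by (simp add: sum_list_sum_nth atLeast0LessThan min_def)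
  then show "weight xs j = xs ! j * (xs ! j - 1) + 2 * (\<Sum>i<j. xs ! j - xs ! i)"
    unfolding weight_def by (simp add: sum_subtractf)
qed

lemma has_312_iff:
  assumes "distinct xs" "set xs = {1..int n}" "length xs = n"
  shows "has_312 xs \<longleftrightarrow>
    (\<Sum>i<n. weight xs i - above_sum (int n) (Max (set (take (Suc i) xs))) (xs ! i)) \<noteq> 0"
proof -
  define M where "M i = Max (set (take (Suc i) xs))" for i
  \<comment> \<open>These are the \<open>j\<close> for which \<open>M i\<close>,
    \<open>xs ! i\<close>, \<open>xs ! j\<close> form a 312.\<close>
  define A where "A i = {j. i < j \<and> j < n \<and> xs ! i < xs ! j \<and> xs ! j < M i}" for i
  have M_in: "\<exists>k\<le>i. M i = xs ! k" and M_ge: "\<And>k. k \<le> i \<Longrightarrow> xs ! k \<le> M i" if "i < n" for i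
  proof -
    have set: "set (take (Suc i) xs) = (!) xs ` {..i}"
      using that assms(3) nth_image[of "Suc i" xs] by (simp add: atLeast0LessThan lessThan_Suc_atMost)
    have "M i \<in> (!) xs ` {..i}"
      unfolding M_def set by (rule Max_in) auto
    then show "\<exists>k\<le>i. M i = xs ! k"
      by auto
    show "xs ! k \<le> M i" if "k \<le> i" for k
      unfolding M_def set using that by (intro Max_ge) auto
  qed
  have pairs: "4 * (\<Sum>j\<in>{i<..<n}. max 0 (xs ! j - xs ! i)) =
      4 * (\<Sum>j\<in>A i. xs ! j - xs ! i) + above_sum (int n) (M i) (xs ! i)" if "i < n" for i
  proof -
    define B where "B = {j. i < j \<and> j < n \<and> M i < xs ! j}"
    obtain k where k: "k \<le> i" "M i = xs ! k"
      using M_in[OF \<open>i < n\<close>] by blast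
    \<comment> \<open>\<open>M i\<close> occurs at a position at most \<open>i\<close>, so by
      distinctness no later entry equals it.\<close>
    have ne: "xs ! j < M i \<or> M i < xs ! j" if "i < j" "j < n" for j
      using that k assms nth_eq_iff_index_eq[OF assms(1), of j k] by (auto simp: neq_iff)
    have Mi: "xs ! i \<le> M i" "M i \<le> int n"
      using M_ge[OF \<open>i < n\<close>, of i] k \<open>i < n\<close> assms(2,3) nth_mem[of k xs] by auto
    have "(\<Sum>j\<in>{i<..<n}. max 0 (xs ! j - xs ! i)) =
        (\<Sum>j\<in>A i \<union> B. xs ! j - xs ! i)"
    proof (rule sum.mono_neutral_cong_right)
      show "\<forall>j\<in>{i<..<n} - (A i \<union> B). max 0 (xs ! j - xs ! i) = 0"
        using ne by (fastforce simp: A_def B_def)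
    qed (use Mi in \<open>auto simp: A_def B_def\<close>)
    also have "\<dots> = (\<Sum>j\<in>A i. xs ! j - xs ! i) + (\<Sum>j\<in>B. xs ! j - xs ! i)"
      by (rule sum.union_disjoint) (auto simp: A_def B_def)
    also have "(\<Sum>j\<in>B. xs ! j - xs ! i) = (\<Sum>y\<in>{M i<..int n}. y - xs ! i)"
    proof (rule sum.reindex_bij_betw)
      have "inj_on ((!) xs) B"
        using assms by (auto intro!: inj_on_nth simp: B_def)
      moreover have "(!) xs ` B = {M i<..int n}"
      proof (intro equalityI subsetI)
        fix y assume "y \<in> (!) xs ` B"
        then show "y \<in> {M i<..int n}"
          using assms nth_mem[of _ xs] by (force simp: B_def)
      next
        fix y assume y: "y \<in> {M i<..int n}"
        then have "y \<in> set xs"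
          using assms Mi nth_mem[of i xs] \<open>i < n\<close> by auto
        then obtain j where j: "j < n" "y = xs ! j"
          using assms(3) by (auto simp: in_set_conv_nth)
        \<comment> \<open>A value above the prefix maximum cannot occur at a position up to
          \<open>i\<close>.\<close>
        then have "i < j"
          using M_ge[OF \<open>i < n\<close>, of j] y by (meson greaterThanAtMost_iff not_le)
        then show "y \<in> (!) xs ` B"
          using j y by (auto simp: B_def)
      qed
      ultimately show "bij_betw ((!) xs) B {M i<..int n}"
        by (simp add: bij_betw_def)
    qed
    finally show ?thesis
      using sum_above[OF Mi(2), of "xs ! i"] by (simp add: above_sum_def)
  qed
  \<comment> \<open>The pairs are regrouped by their first entry, to which the bound
    \<open>M i\<close> belongs.\<close>
  have "(\<Sum>j<n. \<Sum>i<j. max 0 (xs ! j - xs ! i)) =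
      (\<Sum>j<n. \<Sum>i\<in>{i\<in>{..<n}. i < j}. max 0 (xs ! j - xs ! i))"
    by (intro sum.cong) auto
  also have "\<dots> = (\<Sum>i<n. \<Sum>j\<in>{j\<in>{..<n}. i < j}. max 0 (xs ! j - xs ! i))"
    by (rule sum.swap_restrict) auto
  also have "\<dots> = (\<Sum>i<n. \<Sum>j\<in>{i<..<n}. max 0 (xs ! j - xs ! i))"
    by (intro sum.cong) auto
  finally have "(\<Sum>i<n. weight xs i - above_sum (int n) (M i) (xs ! i)) =
      (\<Sum>i<n. 4 * (\<Sum>j\<in>{i<..<n}. max 0 (xs ! j - xs ! i)) - above_sum (int n) (M i) (xs ! i))"
    using sum_weight[OF assms] by (simp add: sum_subtractf sum_distrib_left)
  also have "\<dots> = (\<Sum>i<n. 4 * (\<Sum>j\<in>A i. xs ! j - xs ! i))"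
    using pairs by (intro sum.cong) auto
  finally have "(\<Sum>i<n. weight xs i - above_sum (int n) (M i) (xs ! i)) = 0 \<longleftrightarrow>
      (\<forall>i<n. (\<Sum>j\<in>A i. xs ! j - xs ! i) = 0)"
    by (simp, subst sum_nonneg_eq_0_iff) (auto simp: A_def intro!: sum_nonneg)
  \<comment> \<open>What remains is a sum of positive differences, which vanishes only if there are
    none.\<close>
  also have "\<dots> \<longleftrightarrow> (\<forall>i<n. A i = {})"
  proof (intro all_cong)
    fix i
    have "finite (A i)" "\<forall>j\<in>A i. 0 < xs ! j - xs ! i"
      by (auto simp: A_def)
    then show "(\<Sum>j\<in>A i. xs ! j - xs ! i) = 0 \<longleftrightarrow> A i = {}"
      using sum_pos[of "A i" "\<lambda>j. xs ! j - xs ! i"] by fastforce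
  qed
  also have "\<dots> \<longleftrightarrow> \<not> has_312 xs"
  proof
    show "\<forall>i<n. A i = {}" if no: "\<not> has_312 xs"
    proof (intro allI impI equals0I)
      fix i j assume ij: "i < n" "j \<in> A i"
      then obtain k where "k \<le> i" "M i = xs ! k"
        using M_in by blast
      \<comment> \<open>\<open>k = i\<close> is excluded because \<open>xs ! j\<close> lies strictly
        between \<open>xs ! i\<close> and \<open>M i\<close>.\<close>
      then have "k < i" "i < j" "j < length xs" "xs ! i < xs ! j" "xs ! j < xs ! k"
        using ij assms(3) by (auto simp: A_def le_less)
      with no show False
        unfolding has_312_def by blast
    qed
    show "\<not> has_312 xs" if empty: "\<forall>i<n. A i = {}"
    proof
      assume "has_312 xs"
      then obtain i j k where "i < j" "j < k" "k < n" "xs ! j < xs ! k" "xs ! k < xs ! i"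
        using assms(3) unfolding has_312_def by blast
      then have "k \<in> A j"
        using M_ge[of j i] by (auto simp: A_def)
      with empty \<open>j < k\<close> \<open>k < n\<close> show False
        by auto
    qed
  qed
  finally show ?thesis
    unfolding M_def by blast
qed

section \<open>Descending runs\<close>

text \<open>
  The arguments after the list of remaining entries are the last entry \<open>q\<close> of the previous
  descending run, the last entry \<open>p\<close>, length \<open>r\<close> and sum \<open>X\<close> of the current one, and the
  contributions \<open>A\<close> of the completed runs; \<open>bad\<close> records that the last entries of the runs have
  stopped increasing.
\<close>

fun scan :: "int list \<Rightarrow> int \<Rightarrow> int \<Rightarrow> int \<Rightarrow> int \<Rightarrow> int \<Rightarrow> bool \<Rightarrow> int \<times> bool" where
  "scan [] q p r X A bad = (A + below_sum p r X, bad \<or> p \<le> q)"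
| "scan (x # xs) q p r X A bad =
     (if x < p then scan xs q x (r + 1) (X + x) A bad
      else scan xs p x 1 x (A + below_sum p r X) (bad \<or> p \<le> q))"

text \<open>The target value, written with look-ahead; \<open>scan_good\<close> shows that one pass
  over the runs computes it unless the flag is raised.\<close>

fun suffix_sum :: "int list \<Rightarrow> int" where
  "suffix_sum [] = 0"
| "suffix_sum (x # xs) = below_sum (Min (set (x # xs))) 1 x + suffix_sum xs"

text \<open>Linearity in count and sum lets entries with the same suffix minimum be charged
  together.\<close>

lemma below_sum_add: "below_sum m r X + below_sum m s Y = below_sum m (r + s) (X + Y)"
  by (simp add: below_sum_def algebra_simps)

text \<open>The open run, summarised by \<open>r\<close> and \<open>X\<close>, is charged with the
  minimum of \<open>p\<close> and everything after it. At an ascent the induction hypothesis puts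
  all later entries above \<open>p\<close>, so \<open>p\<close> itself is that minimum; otherwise
  the next entry joins the run.\<close>

lemma scan_good:
  assumes "\<not> snd (scan xs q p r X A bad)" "distinct (p # xs)"
  shows "\<not> bad \<and> (\<forall>x\<in>set (p # xs). q < x) \<and>
    fst (scan xs q p r X A bad) = A + below_sum (Min (set (p # xs))) r X + suffix_sum xs"
  using assms
proof (induction xs arbitrary: q p r X A bad)
  case (Cons x xs)
  show ?case
  proof (cases "x < p")
    case True
    then have "Min (set (p # x # xs)) = Min (set (x # xs))"
      by (cases "xs = []") auto
    then show ?thesis
      using Cons.IH[of q x "r + 1" "X + x" A bad] Cons.prems True
        below_sum_add[of "Min (set (x # xs))" r X 1 x] by auto
  next
    case False
    have *: "\<not> (bad \<or> p \<le> q) \<and> (\<forall>y\<in>set (x # xs). p < y) \<and>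
        fst (scan xs p x 1 x (A + below_sum p r X) (bad \<or> p \<le> q)) =
        A + below_sum p r X + below_sum (Min (set (x # xs))) 1 x + suffix_sum xs"
      by (rule Cons.IH) (use Cons.prems False in auto)
    then have "Min (set (p # x # xs)) = p"
      by (intro Min_eqI) auto
    then show ?thesis
      using * False by auto
  qed
qed auto

lemma has_231_Cons: "has_231 xs \<Longrightarrow> has_231 (x # xs)"
  unfolding has_231_def
  by (metis Suc_less_eq length_Cons nth_Cons_Suc)

lemma has_231_Cons2: "p < x \<Longrightarrow> y \<in> set xs \<Longrightarrow> y < p \<Longrightarrow> has_231 (p # x # xs)"
  unfolding has_231_def in_set_conv_nth
  by (force intro: exI[of _ 0] exI[of _ 1])

text \<open>The failure is traced to the left: at an ascent \<open>p < x\<close>, a later entry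
  below \<open>p\<close> completes a 231 with \<open>p\<close> and \<open>x\<close>. The assumption
  on \<open>q\<close> turns \<open>p \<le> q\<close> into a strict inequality.\<close>

lemma scan_bad:
  assumes "snd (scan xs q p r X A bad)" "distinct (p # xs)" "\<forall>x\<in>set (p # xs). q \<noteq> x"
  shows "bad \<or> (\<exists>x\<in>set (p # xs). x < q) \<or> has_231 (p # xs)"
  using assms
proof (induction xs arbitrary: q p r X A bad)
  case (Cons x xs)
  show ?case
  proof (cases "x < p")
    case True
    have "bad \<or> (\<exists>y\<in>set (x # xs). y < q) \<or> has_231 (x # xs)"
      by (rule Cons.IH) (use Cons.prems True in auto)
    then show ?thesis
      using has_231_Cons by auto
  next
    case False
    have "(bad \<or> p \<le> q) \<or> (\<exists>y\<in>set (x # xs). y < p) \<or> has_231 (x # xs)"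
      by (rule Cons.IH) (use Cons.prems False in auto)
    moreover have "p < x"
      using False Cons.prems(2) by auto
    ultimately show ?thesis
      using has_231_Cons has_231_Cons2[of p x _ xs] Cons.prems(3) by (auto simp: le_less)
  qed
qed auto

lemma suffix_sum_eq:
  "suffix_sum xs = (\<Sum>j<length xs. below_sum (Min (set (drop j xs))) 1 (xs ! j))"
  by (induction xs) (simp_all add: sum.lessThan_Suc_shift del: sum.lessThan_Suc)

lemma has_231_iff_suffix_sum:
  assumes "distinct xs" "set xs = {1..int n}" "length xs = n"
  shows "has_231 xs \<longleftrightarrow> (\<Sum>j<n. weight xs j) - suffix_sum xs \<noteq> 0"
proof -
  define m where "m j = Min (set (drop j xs))" for j
  \<comment> \<open>The weak inequality makes \<open>A j\<close> and the set \<open>B\<close> below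
    exhaust the smaller earlier entries without an appeal to distinctness.\<close>
  define A where "A j = {i. i < j \<and> m j \<le> xs ! i \<and> xs ! i < xs ! j}" for j
  have m_in: "\<exists>k. j \<le> k \<and> k < n \<and> m j = xs ! k"
    and m_le: "\<And>k. j \<le> k \<Longrightarrow> k < n \<Longrightarrow> m j \<le> xs ! k" if "j < n" for j
  proof -
    have "m j \<in> set (drop j xs)"
      unfolding m_def using that assms(3) by (intro Min_in) auto
    then obtain k where "k < n - j" "m j = xs ! (j + k)"
      using assms(3) that by (auto simp: in_set_conv_nth)
    then show "\<exists>k. j \<le> k \<and> k < n \<and> m j = xs ! k"
      using that by (intro exI[of _ "j + k"]) auto
    show "m j \<le> xs ! k" if "j \<le> k" "k < n" for k
    proof -
      have "xs ! k = drop j xs ! (k - j)" "k - j < length (drop j xs)"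
        using that assms(3) by auto
      then show ?thesis
        unfolding m_def by (metis List.finite_set Min_le nth_mem)
    qed
  qed
  have pairs: "4 * (\<Sum>i<j. max 0 (xs ! j - xs ! i)) =
      4 * (\<Sum>i\<in>A j. xs ! j - xs ! i) + below_sum (m j) 1 (xs ! j)" if "j < n" for j
  proof -
    define B where "B = {i. i < j \<and> xs ! i < m j}"
    have mj: "m j \<le> xs ! j" "1 \<le> m j"
      using m_le[OF that, of j] m_in[OF that] that assms(2,3) nth_mem[of _ xs] by auto
    have "(\<Sum>i<j. max 0 (xs ! j - xs ! i)) = (\<Sum>i\<in>A j \<union> B. xs ! j - xs ! i)"
    proof (rule sum.mono_neutral_cong_right)
      show "\<forall>i\<in>{..<j} - (A j \<union> B). max 0 (xs ! j - xs ! i) = 0"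
        by (fastforce simp: A_def B_def)
    qed (use mj in \<open>auto simp: A_def B_def\<close>)
    also have "\<dots> = (\<Sum>i\<in>A j. xs ! j - xs ! i) + (\<Sum>i\<in>B. xs ! j - xs ! i)"
      by (rule sum.union_disjoint) (auto simp: A_def B_def)
    also have "(\<Sum>i\<in>B. xs ! j - xs ! i) = (\<Sum>s\<in>{1..<m j}. xs ! j - s)"
    proof (rule sum.reindex_bij_betw)
      have "inj_on ((!) xs) B"
        using assms that by (auto intro!: inj_on_nth simp: B_def)
      moreover have "(!) xs ` B = {1..<m j}"
      proof (intro equalityI subsetI)
        fix s assume "s \<in> (!) xs ` B"
        then show "s \<in> {1..<m j}"
          using assms that nth_mem[of _ xs] by (force simp: B_def)
      next
        fix s assume s: "s \<in> {1..<m j}"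
        then have "s \<in> set xs"
          using assms mj nth_mem[of j xs] that by auto
        then obtain i where i: "i < n" "s = xs ! i"
          using assms(3) by (auto simp: in_set_conv_nth)
        \<comment> \<open>A value below the suffix minimum must have arrived before position
          \<open>j\<close>.\<close>
        then have "i < j"
          using m_le[OF that, of i] s by (meson atLeastLessThan_iff not_le)
        then show "s \<in> (!) xs ` B"
          using i s by (auto simp: B_def)
      qed
      ultimately show "bij_betw ((!) xs) B {1..<m j}"
        by (simp add: bij_betw_def)
    qed
    finally show ?thesis
      using sum_below[OF mj(2), of "xs ! j"] by (simp add: below_sum_def)
  qed
  have "(\<Sum>j<n. weight xs j) - suffix_sum xs =
      (\<Sum>j<n. 4 * (\<Sum>i<j. max 0 (xs ! j - xs ! i)) - below_sum (m j) 1 (xs ! j))"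
    using sum_weight[OF assms] assms(3)
    by (simp add: suffix_sum_eq sum_subtractf sum_distrib_left m_def)
  also have "\<dots> = (\<Sum>j<n. 4 * (\<Sum>i\<in>A j. xs ! j - xs ! i))"
    using pairs by (intro sum.cong) auto
  finally have "(\<Sum>j<n. weight xs j) - suffix_sum xs = 0 \<longleftrightarrow>
      (\<forall>j<n. (\<Sum>i\<in>A j. xs ! j - xs ! i) = 0)"
    by (simp, subst sum_nonneg_eq_0_iff) (auto simp: A_def intro!: sum_nonneg)
  also have "\<dots> \<longleftrightarrow> (\<forall>j<n. A j = {})"
  proof (intro all_cong)
    fix j
    have "finite (A j)" "\<forall>i\<in>A j. 0 < xs ! j - xs ! i"
      by (auto simp: A_def)
    then show "(\<Sum>i\<in>A j. xs ! j - xs ! i) = 0 \<longleftrightarrow> A j = {}"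
      using sum_pos[of "A j" "\<lambda>i. xs ! j - xs ! i"] by fastforce
  qed
  also have "\<dots> \<longleftrightarrow> \<not> has_231 xs"
  proof
    show "\<forall>j<n. A j = {}" if no: "\<not> has_231 xs"
    proof (intro allI impI equals0I)
      fix j i assume ij: "j < n" "i \<in> A j"
      then obtain k where k: "j \<le> k" "k < n" "m j = xs ! k"
        using m_in by blast
      with ij have "k \<noteq> j" "i < j" "xs ! k \<le> xs ! i" "xs ! i < xs ! j"
        by (auto simp: A_def)
      \<comment> \<open>Strictness is recovered from distinctness, as \<open>k\<close> lies after
        \<open>i\<close>.\<close>
      moreover from this have "xs ! k \<noteq> xs ! i"
        using k assms by (simp add: nth_eq_iff_index_eq)
      ultimately have "i < j" "j < k" "k < length xs" "xs ! k < xs ! i" "xs ! i < xs ! j"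
        using k assms(3) by auto
      with no show False
        unfolding has_231_def by blast
    qed
    show "\<not> has_231 xs" if empty: "\<forall>j<n. A j = {}"
    proof
      assume "has_231 xs"
      then obtain i j k where "i < j" "j < k" "k < n" "xs ! k < xs ! i" "xs ! i < xs ! j"
        using assms(3) unfolding has_231_def by blast
      then have "i \<in> A j"
        using m_le[of j k] by (auto simp: A_def)
      with empty \<open>j < k\<close> \<open>k < n\<close> show False
        by auto
    qed
  qed
  finally show ?thesis
    by blast
qed

text \<open>The scan starts with the sentinel \<open>p = n + 1\<close>, an empty run and
  \<open>q = 0\<close>: a first entry extends the run, the sentinel itself is not charged, and every
  entry exceeds \<open>q\<close>.\<close>

lemma has_231_iff:
  assumes "distinct xs" "set xs = {1..int n}" "length xs = n"
    and "scan xs 0 (int n + 1) 0 0 0 False = (A, bad)"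
  shows "has_231 xs \<longleftrightarrow> bad \<or> (\<Sum>j<n. weight xs j) - A \<noteq> 0"
proof (cases bad)
  case True
  have "has_231 ((int n + 1) # xs)"
    using scan_bad[of xs 0 "int n + 1" 0 0 0 False] assms True by auto
  then obtain i j k where ijk: "i < j" "j < k" "k \<le> n"
    "((int n + 1) # xs) ! k < ((int n + 1) # xs) ! i" "((int n + 1) # xs) ! i < ((int n + 1) # xs) ! j"
    using assms(3) unfolding has_231_def by auto
  then have "xs ! (j - 1) \<in> set xs" "((int n + 1) # xs) ! j = xs ! (j - 1)"
    using assms(3) by (auto simp: nth_Cons')
  \<comment> \<open>Nothing exceeds the sentinel, so it cannot be the 2 of a 231, and the occurrence
    lies in \<open>xs\<close>.\<close>
  then have "i \<noteq> 0"
    using ijk assms(2) by (cases i) auto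
  with ijk have "has_231 xs"
    using assms(3) unfolding has_231_def
    by (intro exI[of _ "i - 1"] exI[of _ "j - 1"] exI[of _ "k - 1"]) (auto simp: nth_Cons')
  with True show ?thesis
    by simp
next
  case False
  then have "A = suffix_sum xs"
    using scan_good[of xs 0 "int n + 1" 0 0 0 False] assms by (simp add: below_sum_def)
  with False show ?thesis
    using has_231_iff_suffix_sum[OF assms(1-3)] by simp
qed

section \<open>The detection programs\<close>

declare One_nat_def [simp del]

fun block :: "com list \<Rightarrow> com" where
  "block [] = Skip"
| "block [c] = c"
| "block (c # d # cs) = Seq c (block (d # cs))"

text \<open>
  Register 2 accumulates the result, register 4 counts the entries and register 5 is their sum.
\<close>

definition weight_code :: com where
  "weight_code = block
    [Arith Sub 6 (Reg 1) (Const 1), Arith Mul 6 (Reg 6) (Reg 1), Arith Add 2 (Reg 2) (Reg 6),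
     Arith Mul 6 (Reg 4) (Reg 1), Arith Sub 6 (Reg 6) (Reg 5), Arith Add 6 (Reg 6) (Reg 6),
     Arith Add 2 (Reg 2) (Reg 6), Arith Add 4 (Reg 4) (Const 1), Arith Add 5 (Reg 5) (Reg 1)]"

text \<open>Register 3 holds the prefix maximum; 6 and 7 are scratch.\<close>

definition above_code :: com where
  "above_code = block
    [Arith Sub 6 (Reg 0) (Reg 3), Arith Add 7 (Reg 0) (Reg 3), Arith Add 7 (Reg 7) (Const 1),
     Arith Sub 7 (Reg 7) (Reg 1), Arith Sub 7 (Reg 7) (Reg 1), Arith Mul 6 (Reg 6) (Reg 7),
     Arith Add 6 (Reg 6) (Reg 6), Arith Sub 2 (Reg 2) (Reg 6)]"

text \<open>The maximum is updated first because it includes the arriving entry, whereas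
  \<open>weight_code\<close> reads the count and the sum of the entries before it.\<close>

definition update_312 :: com where
  "update_312 = block
    [Cond Lt (Reg 3) (Reg 1) (Move 3 (Reg 1)) Skip, above_code, weight_code]"

text \<open>Registers 8, 3, 9, 10, 11 are the arguments \<open>q\<close>, \<open>p\<close>, \<open>r\<close>, \<open>X\<close>, \<open>bad\<close> of \<^const>\<open>scan\<close>.\<close>

definition close_code :: com where
  "close_code = block
    [Cond Le (Reg 3) (Reg 8) (Move 11 (Const 1)) Skip,
     Arith Sub 6 (Reg 3) (Const 1), Arith Add 7 (Reg 10) (Reg 10), Arith Mul 9 (Reg 9) (Reg 3),
     Arith Sub 7 (Reg 7) (Reg 9), Arith Mul 6 (Reg 6) (Reg 7), Arith Add 6 (Reg 6) (Reg 6),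
     Arith Sub 2 (Reg 2) (Reg 6)]"

text \<open>\<open>close_code\<close> spoils register 9; the resets leave an empty run, so both
  branches append the entry in the same way.\<close>

definition update_231 :: com where
  "update_231 = block
    [Cond Lt (Reg 1) (Reg 3) Skip
       (block [close_code, Move 8 (Reg 3), Move 9 (Const 0), Move 10 (Const 0)]),
     Move 3 (Reg 1), Arith Add 9 (Reg 9) (Const 1), Arith Add 10 (Reg 10) (Reg 1), weight_code]"

text \<open>The last run is still open. A raised flag overrides the difference in register 2, about
  which \<open>scan_good\<close> says nothing in that case.\<close>

definition output_231 :: com where
  "output_231 = block
    [close_code, Cond Eq (Reg 11) (Const 0) Skip (Move 2 (Const 1))]"

definition init_231 :: com where
  "init_231 = Arith Add 3 (Reg 0) (Const 1)"

definition complement_code :: com where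
  "complement_code = Seq (Arith Add 6 (Reg 0) (Const 1)) (Arith Sub 1 (Reg 6) (Reg 1))"

section \<open>Size bounds and correctness of the code blocks\<close>

lemma abs_mult_le:
  fixes a b c d :: int
  shows "\<bar>a\<bar> \<le> c \<Longrightarrow> \<bar>b\<bar> \<le> d \<Longrightarrow> \<bar>a * b\<bar> \<le> c * d"
  by (simp add: abs_mult mult_mono)

lemma powers_le:
  fixes N :: int
  assumes "1 \<le> N"
  shows "N \<le> N ^ 2" "N ^ 2 \<le> N ^ 3" "N ^ 3 \<le> N ^ 4"
  using assms power_increasing[of 1 2 N] by (simp_all add: power_increasing)

lemma abs_weight_le:
  fixes x j S N :: int
  assumes "0 \<le> x" "x < N" "0 \<le> j" "j \<le> N" "0 \<le> S" "S \<le> N ^ 2"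
  shows "\<bar>(x - 1) * x\<bar> \<le> N ^ 2" "\<bar>j * x\<bar> \<le> N ^ 2" "\<bar>j * x - S\<bar> \<le> 2 * N ^ 2"
    "\<bar>x * (x - 1) + 2 * (j * x - S)\<bar> \<le> 5 * N ^ 2"
proof -
  show 1: "\<bar>(x - 1) * x\<bar> \<le> N ^ 2" "\<bar>j * x\<bar> \<le> N ^ 2"
    unfolding power2_eq_square by (rule abs_mult_le; use assms in linarith)+
  then show 2: "\<bar>j * x - S\<bar> \<le> 2 * N ^ 2"
    using assms by linarith
  have "\<bar>a + 2 * b\<bar> \<le> 5 * M" if "\<bar>a\<bar> \<le> M" "\<bar>b\<bar> \<le> 2 * M" for a b M :: int
    using that by linarith
  from this[OF 1(1) 2] show "\<bar>x * (x - 1) + 2 * (j * x - S)\<bar> \<le> 5 * N ^ 2"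
    by (simp only: mult.commute)
qed

text \<open>Quantifying over all final states with the listed registers lets blocks be chained
  without tracking scratch values. The slack between 100 and 2000 absorbs the intermediate
  terms.\<close>

lemma wp_weight_code:
  assumes N: "N = int n + 1"
    and s: "0 \<le> s 1" "s 1 < N" "0 \<le> s 4" "s 4 < N" "0 \<le> s 5" "s 5 \<le> N ^ 2" "\<bar>s 2\<bar> \<le> 100 * N ^ 4"
    and Q: "\<And>t. t 2 = s 2 + (s 1 * (s 1 - 1) + 2 * (s 4 * s 1 - s 5)) \<Longrightarrow> t 4 = s 4 + 1 \<Longrightarrow>
      t 5 = s 5 + s 1 \<Longrightarrow> (\<And>r. r \<notin> {2, 4, 5, 6} \<Longrightarrow> t r = s r) \<Longrightarrow> Q t"
  shows "wp (word_bits n) weight_code Q s"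
proof -
  note fits = fits_word_bits[of _ n, folded N]
  have "1 \<le> N"
    using N by simp
  note bounds = abs_weight_le[OF s(1-3) less_imp_le[OF s(4)] s(5,6), unfolded abs_le_iff mult.commute[of "s 4" "s 1"]]
    powers_le[OF this] s \<open>1 \<le> N\<close>
  show ?thesis
    unfolding weight_code_def
    by (simp add: mult.commute[of "s 4" "s 1"], intro conjI fits Q; (use bounds in linarith)?)
      (simp_all)
qed

lemma abs_above_sum_le:
  fixes n M x N :: int
  assumes "0 \<le> M" "M \<le> n" "0 \<le> x" "x \<le> n" "N = n + 1"
  shows "\<bar>(n - M) * (n + (M + 1) - 2 * x)\<bar> \<le> 2 * N ^ 2" "\<bar>above_sum n M x\<bar> \<le> 4 * N ^ 2"
proof -
  have "\<bar>(n - M) * (n + (M + 1) - 2 * x)\<bar> \<le> N * (2 * N)"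
    by (rule abs_mult_le; use assms in linarith)
  then show 1: "\<bar>(n - M) * (n + (M + 1) - 2 * x)\<bar> \<le> 2 * N ^ 2"
    by (simp add: power2_eq_square)
  have "above_sum n M x = 2 * ((n - M) * (n + (M + 1) - 2 * x))"
    by (simp add: above_sum_def)
  then show "\<bar>above_sum n M x\<bar> \<le> 4 * N ^ 2"
    using 1 by linarith
qed

lemma wp_above_code:
  assumes N: "N = int n + 1"
    and s: "0 \<le> s 3" "s 3 \<le> s 0" "0 \<le> s 1" "s 1 \<le> s 0" "s 0 = int n" "\<bar>s 2\<bar> \<le> 100 * N ^ 4"
    and Q: "\<And>t. t 2 = s 2 - above_sum (s 0) (s 3) (s 1) \<Longrightarrow>
      (\<And>r. r \<notin> {2, 6, 7} \<Longrightarrow> t r = s r) \<Longrightarrow> Q t"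
  shows "wp (word_bits n) above_code Q s"
proof -
  note fits = fits_word_bits[of _ n, folded N]
  have "1 \<le> N"
    using N by simp
  have "N = s 0 + 1"
    using N s(5) by simp
  note bounds = abs_above_sum_le[OF s(1-4) this, unfolded abs_le_iff]
    powers_le[OF \<open>1 \<le> N\<close>] s(1-4,6) \<open>1 \<le> N\<close> \<open>N = s 0 + 1\<close>
  show ?thesis
    unfolding above_code_def
    by (simp, intro conjI fits Q; (use bounds in linarith)?)
      (simp_all add: above_sum_def)
qed

text \<open>The factor \<open>p - 1\<close> meets one of order \<open>N ^ 2\<close>; up to
  \<open>N\<close> such cubic contributions explain words sized for \<open>N ^ 4\<close>.\<close>

lemma abs_below_sum_le:
  fixes p r X N :: int
  assumes "0 \<le> p" "p \<le> N" "0 \<le> r" "r \<le> N" "0 \<le> X" "X \<le> N ^ 2" "1 \<le> N"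
  shows "\<bar>r * p\<bar> \<le> N ^ 2" "\<bar>(p - 1) * (X + X - r * p)\<bar> \<le> 3 * N ^ 3"
    "\<bar>below_sum p r X\<bar> \<le> 6 * N ^ 3"
proof -
  show 1: "\<bar>r * p\<bar> \<le> N ^ 2"
    unfolding power2_eq_square by (rule abs_mult_le; use assms in linarith)+
  have "\<bar>(p - 1) * (X + X - r * p)\<bar> \<le> N * (3 * N ^ 2)"
    by (rule abs_mult_le; use assms 1 in linarith)+
  then show 2: "\<bar>(p - 1) * (X + X - r * p)\<bar> \<le> 3 * N ^ 3"
    by (simp add: power3_eq_cube power2_eq_square)
  then show "\<bar>below_sum p r X\<bar> \<le> 6 * N ^ 3"
    unfolding below_sum_def mult_2[of X] by linarith
qed

lemma wp_close_code:
  assumes N: "N = int n + 1"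
    and s: "0 \<le> s 3" "s 3 \<le> N" "0 \<le> s 9" "s 9 \<le> N" "0 \<le> s 10" "s 10 \<le> N ^ 2"
      "\<bar>s 2\<bar> \<le> 100 * N ^ 4"
    and Q: "\<And>t. t 2 = s 2 - below_sum (s 3) (s 9) (s 10) \<Longrightarrow>
      t 11 = (if s 3 \<le> s 8 then 1 else s 11) \<Longrightarrow>
      (\<And>r. r \<notin> {2, 6, 7, 9, 11} \<Longrightarrow> t r = s r) \<Longrightarrow> Q t"
  shows "wp (word_bits n) close_code Q s"
proof -
  note fits = fits_word_bits[of _ n, folded N]
  have "1 \<le> N"
    using N by simp
  note bounds = abs_below_sum_le[OF s(1-6) this, unfolded mult_2[symmetric] abs_le_iff]
    powers_le[OF this] s \<open>1 \<le> N\<close>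
  show ?thesis
    unfolding close_code_def
    by (simp, intro conjI impI fits Q; (use bounds in linarith)?)
      (simp_all add: below_sum_def)
qed

section \<open>Invariants of the two passes\<close>

locale stream_permutation =
  fixes xs :: "int list" and n :: nat and N :: int
  assumes distinct: "distinct xs" and set: "set xs = {1..int n}" and len: "length xs = n"
    and N: "N = int n + 1"
begin

lemma nth_bounds:
  assumes "k < n"
  shows "1 \<le> xs ! k" "xs ! k < N"
  using nth_mem[of k xs] assms set len N by auto

lemma prefix_sum_bounds:
  assumes "k \<le> n"
  shows "0 \<le> sum_list (take k xs)" "sum_list (take k xs) \<le> N ^ 2"
proof -
  have "0 \<le> sum_list (take k xs) \<and> sum_list (take k xs) \<le> int k * N"
    using assms
  proof (induction k)
    case (Suc k)
    then show ?case
      using nth_bounds[of k] len by (simp add: take_Suc_conv_app_nth algebra_simps)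
  qed simp
  moreover have "int k * N \<le> N * N"
    using assms N by (intro mult_right_mono) auto
  ultimately show "0 \<le> sum_list (take k xs)" "sum_list (take k xs) \<le> N ^ 2"
    by (auto simp: power2_eq_square)
qed

lemma N_ge: "1 \<le> N"
  using N by simp

lemma linear_growth: "k \<le> n \<Longrightarrow> 20 * int k * N ^ 3 \<le> 20 * N ^ 4"
  using mult_right_mono[of "int k" N "N ^ 3"] N by (simp add: power_Suc[symmetric] del: power_Suc)

text \<open>One update changes register 2 by at most \<open>5 * N ^ 2 + 6 * N ^ 3\<close>, within
  the allowance of \<open>20 * N ^ 3\<close> per entry; \<open>linear_growth\<close> then gives
  \<open>20 * N ^ 4\<close> overall.\<close>

definition common :: "nat \<Rightarrow> state \<Rightarrow> bool" where
  "common k s \<longleftrightarrow> s 0 = int n \<and> s 4 = int k \<and> s 5 = sum_list (take k xs) \<and>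
     \<bar>s 2\<bar> \<le> 20 * int k * N ^ 3"

text \<open>The inserted 0 is the initial content of register 3; it lies below all entries and
  serves the empty prefix.\<close>

definition inv_312 :: "nat \<Rightarrow> state \<Rightarrow> bool" where
  "inv_312 k s \<longleftrightarrow> common k s \<and> s 3 = Max (insert 0 (set (take k xs))) \<and>
     s 2 = (\<Sum>i<k. weight xs i - above_sum (int n) (Max (set (take (Suc i) xs))) (xs ! i))"

lemma Max_prefix:
  assumes "k < n"
  shows "max (Max (insert 0 (set (take k xs)))) (xs ! k) = Max (set (take (Suc k) xs))"
    "Max (insert 0 (set (take (Suc k) xs))) = Max (set (take (Suc k) xs))"
    "0 \<le> Max (set (take (Suc k) xs))" "Max (set (take (Suc k) xs)) < N"
proof -
  have set_take: "set (take (Suc k) xs) = insert (xs ! k) (set (take k xs))"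
    using assms len by (simp add: take_Suc_conv_app_nth)
  have "xs ! k \<le> Max (set (take (Suc k) xs))"
    unfolding set_take by (rule Max_ge) auto
  then show nonneg: "0 \<le> Max (set (take (Suc k) xs))"
    using nth_bounds(1)[OF assms] by linarith
  then show zero: "Max (insert 0 (set (take (Suc k) xs))) = Max (set (take (Suc k) xs))"
    unfolding set_take by (subst Max_insert) auto
  have "max (Max (insert 0 (set (take k xs)))) (xs ! k) = Max (insert (xs ! k) (insert 0 (set (take k xs))))"
    by (subst Max_insert) auto
  also have "\<dots> = Max (insert 0 (set (take (Suc k) xs)))"
    unfolding set_take by (simp only: insert_commute)
  finally show "max (Max (insert 0 (set (take k xs)))) (xs ! k) = Max (set (take (Suc k) xs))"
    unfolding zero .
  have "Max (set (take (Suc k) xs)) \<in> set (take (Suc k) xs)"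
    unfolding set_take by (rule Max_in) auto
  then show "Max (set (take (Suc k) xs)) < N"
    using set_take_subset[of "Suc k" xs] set N by auto
qed

lemma wp_update_312:
  assumes "k < n" "inv_312 k s" "s 1 = xs ! k"
  shows "wp (word_bits n) update_312 (inv_312 (Suc k)) s"
proof -
  define M where "M = Max (set (take (Suc k) xs))"
  note x = nth_bounds[OF \<open>k < n\<close>]
  note Max = Max_prefix[OF \<open>k < n\<close>, folded M_def]
  note powers = powers_le[OF N_ge] N_ge
  have s: "s 0 = int n" "s 4 = int k" "s 5 = sum_list (take k xs)"
      "s 3 = Max (insert 0 (set (take k xs)))" "\<bar>s 2\<bar> \<le> 20 * int k * N ^ 3"
      "s 2 = (\<Sum>i<k. weight xs i - above_sum (int n) (Max (set (take (Suc i) xs))) (xs ! i))"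
    using assms(2) unfolding inv_312_def common_def by auto
  have sum: "0 \<le> s 5" "s 5 \<le> N ^ 2"
    using prefix_sum_bounds[of k] \<open>k < n\<close> s by auto
  have small: "\<bar>s 2\<bar> \<le> 20 * N ^ 4"
    using s(5) linear_growth[of k] \<open>k < n\<close> by linarith
  have weight: "\<bar>weight xs k\<bar> \<le> 5 * N ^ 2"
    using abs_weight_le(4)[of "xs ! k" N "s 4" "s 5"] x sum N \<open>k < n\<close> s
    unfolding weight_def by auto
  have above: "\<bar>above_sum (int n) M (xs ! k)\<bar> \<le> 4 * N ^ 2"
    using x Max(3,4) N by (intro abs_above_sum_le) auto
  \<comment> \<open>Either branch leaves \<open>M\<close> in register 3; without the move the state
    already equals \<open>s(3 := M)\<close>.\<close>
  have max: "wp (word_bits n) (Cond Lt (Reg 3) (Reg 1) (Move 3 (Reg 1)) Skip) Q s"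
    if "Q (s(3 := M))" for Q
  proof (cases "s 3 < s 1")
    case True
    then have "s 1 = M"
      using Max(1) assms(3) s(4) by linarith
    moreover have "fits (word_bits n) M"
      by (rule fits_word_bits[of _ n, folded N]) (use Max(3,4) powers N in linarith)
    ultimately show ?thesis
      using that True by simp
  next
    case False
    then have "s 3 = M"
      using Max(1) assms(3) s(4) by linarith
    then have "s(3 := M) = s"
      by auto
    then show ?thesis
      using that False by simp
  qed
  show ?thesis
    unfolding update_312_def block.simps wp.simps(5)
  proof (rule max, rule wp_above_code[OF N])
    fix t
    assume t2: "t 2 = (s(3 := M)) 2 - above_sum ((s(3 := M)) 0) ((s(3 := M)) 3) ((s(3 := M)) 1)"
      and t: "\<And>r. r \<notin> {2, 6, 7} \<Longrightarrow> t r = (s(3 := M)) r"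
    have t_regs: "t 0 = int n" "t 1 = xs ! k" "t 3 = M" "t 4 = int k" "t 5 = s 5"
      "t 2 = s 2 - above_sum (int n) M (xs ! k)"
      using t t2 s assms(3) by auto
    have "\<bar>t 2\<bar> \<le> 100 * N ^ 4"
      unfolding t_regs using small above powers by linarith
    show "wp (word_bits n) weight_code (inv_312 (Suc k)) t"
    proof (rule wp_weight_code[OF N])
      fix u
      assume u: "u 2 = t 2 + (t 1 * (t 1 - 1) + 2 * (t 4 * t 1 - t 5))" "u 4 = t 4 + 1"
        "u 5 = t 5 + t 1" "\<And>r. r \<notin> {2, 4, 5, 6} \<Longrightarrow> u r = t r"
      have u2: "u 2 = s 2 + (weight xs k - above_sum (int n) M (xs ! k))"
        unfolding u(1) t_regs weight_def s by simp
      have "\<bar>u 2\<bar> \<le> 20 * int k * N ^ 3 + 20 * N ^ 3"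
        unfolding u2 using s(5) weight above powers by linarith
      then show "inv_312 (Suc k) u"
        unfolding inv_312_def common_def using u t_regs s(3) u2 s(6) Max(2) len \<open>k < n\<close>
        by (simp add: take_Suc_conv_app_nth algebra_simps M_def)
    qed (use t_regs x sum \<open>\<bar>t 2\<bar> \<le> 100 * N ^ 4\<close> N \<open>k < n\<close> in auto)
  qed (use s x Max(3,4) N small assms(3) powers in auto)
qed

text \<open>Instead of describing the runs of the prefix, the invariant says that resuming
  \<open>scan\<close> from the registers reproduces the full scan. The accumulator of
  \<open>scan\<close> is not stored: it is recovered as the weight total so far minus register
  2.\<close>

definition inv_231 :: "nat \<Rightarrow> state \<Rightarrow> bool" where
  "inv_231 k s \<longleftrightarrow> common k s \<and> 0 \<le> s 3 \<and> s 3 \<le> N \<and> 0 \<le> s 9 \<and> s 9 \<le> int k \<and>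
     0 \<le> s 10 \<and> s 10 \<le> int k * N \<and>
     scan (drop k xs) (s 8) (s 3) (s 9) (s 10) ((\<Sum>j<k. weight xs j) - s 2) (s 11 \<noteq> 0) =
       scan xs 0 N 0 0 0 False"

lemma square_growth: "k \<le> n \<Longrightarrow> int k * N \<le> N ^ 2"
  unfolding power2_eq_square using N by (intro mult_right_mono) auto

lemma wp_update_231:
  assumes "k < n" "inv_231 k s" "s 1 = xs ! k"
  shows "wp (word_bits n) update_231 (inv_231 (Suc k)) s"
proof -
  define x where "x = xs ! k"
  \<comment> \<open>The primed values describe the run to which \<open>x\<close> is then appended,
    either the old one or an empty one after closing; \<open>A'\<close> is the contribution just
    subtracted.\<close>
  define q' r' X' A' b' where
    "q' = (if x < s 3 then s 8 else s 3)" and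
    "r' = (if x < s 3 then s 9 else 0)" and
    "X' = (if x < s 3 then s 10 else 0)" and
    "A' = (if x < s 3 then 0 else below_sum (s 3) (s 9) (s 10))" and
    "b' \<longleftrightarrow> (if x < s 3 then s 11 \<noteq> 0 else s 11 \<noteq> 0 \<or> s 3 \<le> s 8)"
  note defs = q'_def r'_def X'_def A'_def b'_def
  note fits = fits_word_bits[of _ n, folded N]
  note x = nth_bounds[OF \<open>k < n\<close>, folded x_def]
  note powers = powers_le[OF N_ge] N_ge
  have k: "int k + 1 \<le> N" "int k * N \<le> N ^ 2" "(int k + 1) * N \<le> N ^ 2"
    using \<open>k < n\<close> N square_growth[of k] square_growth[of "Suc k"] by (auto simp: algebra_simps)
  have s: "s 0 = int n" "s 4 = int k" "s 5 = sum_list (take k xs)"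
      "\<bar>s 2\<bar> \<le> 20 * int k * N ^ 3" "0 \<le> s 3" "s 3 \<le> N" "0 \<le> s 9" "s 9 \<le> int k"
      "0 \<le> s 10" "s 10 \<le> int k * N"
    and scan: "scan (x # drop (Suc k) xs) (s 8) (s 3) (s 9) (s 10)
        ((\<Sum>j<k. weight xs j) - s 2) (s 11 \<noteq> 0) = scan xs 0 N 0 0 0 False"
    using assms(1,2) len unfolding inv_231_def common_def x_def
    by (auto simp: Cons_nth_drop_Suc)
  have sum: "0 \<le> s 5" "s 5 \<le> N ^ 2"
    using prefix_sum_bounds[of k] \<open>k < n\<close> s by auto
  have small: "\<bar>s 2\<bar> \<le> 20 * N ^ 4"
    using s(4) linear_growth[of k] \<open>k < n\<close> by linarith
  have weight: "\<bar>weight xs k\<bar> \<le> 5 * N ^ 2"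
    using abs_weight_le(4)[of x N "s 4" "s 5"] x sum N \<open>k < n\<close> s
    unfolding weight_def x_def by auto
  have below: "\<bar>A'\<bar> \<le> 6 * N ^ 3"
    using abs_below_sum_le(3)[of "s 3" N "s 9" "s 10"] s k N_ge unfolding A'_def by auto
  have bounds': "0 \<le> r'" "r' \<le> int k" "0 \<le> X'" "X' \<le> int k * N"
    unfolding defs using s N_ge by auto
  have scan': "scan (drop (Suc k) xs) q' x (r' + 1) (X' + x) ((\<Sum>j<k. weight xs j) - (s 2 - A')) b' =
      scan xs 0 N 0 0 0 False"
    using scan unfolding defs by (auto split: if_splits simp: algebra_simps disj_commute)
  have run: "wp (word_bits n) (Cond Lt (Reg 1) (Reg 3) Skip
      (Seq close_code (Seq (Move 8 (Reg 3)) (Seq (Move 9 (Const 0)) (Move 10 (Const 0)))))) Q s"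
    if Q: "\<And>t. t 0 = int n \<Longrightarrow> t 1 = x \<Longrightarrow> t 2 = s 2 - A' \<Longrightarrow> t 4 = int k \<Longrightarrow> t 5 = s 5 \<Longrightarrow>
      t 8 = q' \<Longrightarrow> t 9 = r' \<Longrightarrow> t 10 = X' \<Longrightarrow> (t 11 \<noteq> 0) = b' \<Longrightarrow> Q t" for Q
  proof (cases "x < s 3")
    case True
    then show ?thesis
      using s assms(3) by (auto simp: defs x_def intro!: Q)
  next
    case False
    have "wp (word_bits n)
        (Seq close_code (Seq (Move 8 (Reg 3)) (Seq (Move 9 (Const 0)) (Move 10 (Const 0))))) Q s"
      unfolding wp.simps(5)
    proof (rule wp_close_code[OF N])
      fix t
      assume t: "t 2 = s 2 - below_sum (s 3) (s 9) (s 10)"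
        "t 11 = (if s 3 \<le> s 8 then 1 else s 11)"
        "\<And>r. r \<notin> {2, 6, 7, 9, 11} \<Longrightarrow> t r = s r"
      show "wp (word_bits n) (Move 8 (Reg 3))
          (wp (word_bits n) (Move 9 (Const 0)) (wp (word_bits n) (Move 10 (Const 0)) Q)) t"
        unfolding wp.simps
        by (intro conjI fits Q)
          (use t s powers False assms(3) in \<open>auto simp: defs x_def\<close>)
    qed (use s k small powers in auto)
    then show ?thesis
      using False assms(3) by (simp add: x_def)
  qed
  show ?thesis
    unfolding update_231_def block.simps wp.simps(5)[of _ "Cond _ _ _ _ _"]
  proof (rule run)
    fix t :: state
    assume t: "t 0 = int n" "t 1 = x" "t 2 = s 2 - A'" "t 4 = int k" "t 5 = s 5"
      "t 8 = q'" "t 9 = r'" "t 10 = X'" "(t 11 \<noteq> 0) = b'"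
    have "\<bar>t 2\<bar> \<le> 100 * N ^ 4"
      unfolding t using small below powers by linarith
    define t' where "t' = t(3 := x, 9 := r' + 1, 10 := X' + x)"
    have "wp (word_bits n) weight_code (inv_231 (Suc k)) t'"
    proof (rule wp_weight_code[OF N])
      fix u
      assume u: "u 2 = t' 2 + (t' 1 * (t' 1 - 1) + 2 * (t' 4 * t' 1 - t' 5))" "u 4 = t' 4 + 1"
        "u 5 = t' 5 + t' 1" "\<And>r. r \<notin> {2, 4, 5, 6} \<Longrightarrow> u r = t' r"
      have u2: "u 2 = s 2 - A' + weight xs k"
        unfolding u(1) t'_def using t s by (simp add: weight_def x_def)
      have "\<bar>u 2\<bar> \<le> 20 * int k * N ^ 3 + 20 * N ^ 3"
        unfolding u2 using s(4) weight below powers by linarith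
      moreover have "(\<Sum>j<Suc k. weight xs j) - u 2 = (\<Sum>j<k. weight xs j) - (s 2 - A')"
        unfolding u2 by simp
      note scan'[folded this]
      moreover have "u 0 = int n" "u 3 = x" "u 4 = int (Suc k)" "u 5 = sum_list (take (Suc k) xs)"
          "u 8 = q'" "u 9 = r' + 1" "u 10 = X' + x" "u 11 = t 11"
        using u(2-4) t s(3) len \<open>k < n\<close> by (simp_all add: t'_def take_Suc_conv_app_nth x_def)
      ultimately show "inv_231 (Suc k) u"
        unfolding inv_231_def common_def using x bounds' t(9)
        by (simp add: distrib_right distrib_left)
    qed (use t x sum \<open>\<bar>t 2\<bar> \<le> 100 * N ^ 4\<close> N \<open>k < n\<close> in \<open>auto simp: t'_def\<close>)
    moreover have "fits (word_bits n) x" "fits (word_bits n) (r' + 1)" "fits (word_bits n) (X' + x)"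
      by (rule fits; use x bounds' k powers in linarith)+
    ultimately show "wp (word_bits n) (Seq (Move 3 (Reg 1)) (Seq (Arith Add 9 (Reg 9) (Const 1))
        (Seq (Arith Add 10 (Reg 10) (Reg 1)) weight_code))) (inv_231 (Suc k)) t"
      using t by (simp add: t'_def)
  qed
qed

end

section \<open>From the invariants to the four patterns\<close>

context stream_permutation
begin

text \<open>Preprocessing of the arriving value changes only registers 1 and 6, so it can precede an
  update without disturbing the invariants.\<close>

lemma inv_scratch:
  assumes "\<And>r. r \<notin> {1, 6} \<Longrightarrow> t r = s r"
  shows "inv_312 k s \<Longrightarrow> inv_312 k t" "inv_231 k s \<Longrightarrow> inv_231 k t"
proof -
  have "t 0 = s 0" "t 2 = s 2" "t 3 = s 3" "t 4 = s 4" "t 5 = s 5" "t 8 = s 8" "t 9 = s 9"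
    "t 10 = s 10" "t 11 = s 11"
    by (simp_all add: assms)
  note eqs = this
  show "inv_312 k s \<Longrightarrow> inv_312 k t" "inv_231 k s \<Longrightarrow> inv_231 k t"
    unfolding inv_312_def inv_231_def common_def eqs by blast+
qed

lemma inv_312_output:
  assumes "inv_312 n s"
  shows "has_312 xs \<longleftrightarrow> s 2 \<noteq> 0"
  using has_312_iff[OF distinct set len] assms unfolding inv_312_def by simp

lemma wp_init_231: "wp (word_bits n) init_231 (inv_231 0) ((\<lambda>_. 0)(0 := int n))"
  using fits_word_bits[of N n] powers_le[OF N_ge] N_ge N
  unfolding init_231_def inv_231_def common_def by (simp add: add.commute)

lemma wp_output_231:
  assumes "inv_231 n s"
  shows "wp (word_bits n) output_231 (\<lambda>u. has_231 xs = (u 2 \<noteq> 0)) s"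
proof -
  have s: "\<bar>s 2\<bar> \<le> 20 * int n * N ^ 3" "0 \<le> s 3" "s 3 \<le> N" "0 \<le> s 9" "s 9 \<le> int n"
      "0 \<le> s 10" "s 10 \<le> int n * N"
    \<comment> \<open>Nothing is left to read, so the invariant reduces to the base case of
      \<open>scan\<close>, which closes the last run just as \<open>close_code\<close> does.\<close>
    and scan: "scan xs 0 (int n + 1) 0 0 0 False =
        (((\<Sum>j<n. weight xs j) - s 2) + below_sum (s 3) (s 9) (s 10), s 11 \<noteq> 0 \<or> s 3 \<le> s 8)"
    using assms len N unfolding inv_231_def common_def by auto
  have iff: "has_231 xs \<longleftrightarrow> s 11 \<noteq> 0 \<or> s 3 \<le> s 8 \<or> s 2 - below_sum (s 3) (s 9) (s 10) \<noteq> 0"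
    using has_231_iff[OF distinct set len scan] by auto
  have "fits (word_bits n) 1"
    by (rule fits_word_bits[of _ n, folded N]) (use powers_le[OF N_ge] N_ge in linarith)
  show ?thesis
    unfolding output_231_def block.simps wp.simps(5)
  proof (rule wp_close_code[OF N])
    fix t :: state
    assume "t 2 = s 2 - below_sum (s 3) (s 9) (s 10)" "t 11 = (if s 3 \<le> s 8 then 1 else s 11)"
    then show "wp (word_bits n) (Cond Eq (Reg 11) (Const 0) Skip (Move 2 (Const 1)))
        (\<lambda>u. has_231 xs = (u 2 \<noteq> 0)) t"
      using iff \<open>fits (word_bits n) 1\<close> by auto
  next
    show "\<bar>s 2\<bar> \<le> 100 * N ^ 4"
      using s(1) linear_growth[of n] powers_le[OF N_ge] N_ge by linarith
    show "s 9 \<le> N" "s 10 \<le> N ^ 2"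
      using s square_growth[of n] N by linarith+
  qed (use s in auto)
qed

end

text \<open>Covers the unchanged and the complemented input. Bijectivity makes the transformed
  entries again a permutation of the values 1 to \<open>n\<close>.\<close>

locale input_map =
  fixes pre :: com and f :: "nat \<Rightarrow> int \<Rightarrow> int"
  assumes bij: "bij_betw (f n) {1..int n} {1..int n}"
    and wp_pre: "1 \<le> s 1 \<Longrightarrow> s 1 \<le> int n \<Longrightarrow> s 0 = int n \<Longrightarrow>
      (\<And>t. t 1 = f n (s 1) \<Longrightarrow> (\<And>r. r \<notin> {1, 6} \<Longrightarrow> t r = s r) \<Longrightarrow> Q t) \<Longrightarrow>
      wp (word_bits n) pre Q s"
begin

lemma stream_permutation:
  assumes "\<pi> \<in> permutations_of_set {1..n}"
  shows "stream_permutation (map (\<lambda>v. f n (int v)) \<pi>) n (int n + 1)"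
proof
  have \<pi>: "distinct \<pi>" "set \<pi> = {1..n}"
    using assms by (auto dest: permutations_of_setD)
  have image: "int ` {1..n} = {1..int n}"
    by (simp add: image_int_atLeastAtMost)
  show "length (map (\<lambda>v. f n (int v)) \<pi>) = n"
    using \<pi> distinct_card[of \<pi>] by simp
  show "set (map (\<lambda>v. f n (int v)) \<pi>) = {1..int n}"
    using bij[of n] \<pi> image by (simp add: bij_betw_def image_image[symmetric])
  have "inj_on (\<lambda>v. f n (int v)) {1..n}"
    using comp_inj_on[of int "{1..n}" "f n"] bij[of n] image by (simp add: bij_betw_def comp_def)
  then show "distinct (map (\<lambda>v. f n (int v)) \<pi>)"
    using \<pi> by (simp add: distinct_map)
qed simp

text \<open>The invariant holds between entries; \<open>scratch\<close> carries it across the input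
  write and \<open>pre\<close>, and \<open>c1\<close> then starts from the transformed
  value.\<close>

lemma detects_invariant:
  assumes run: "\<And>\<pi> n. \<pi> \<in> permutations_of_set {1..n} \<Longrightarrow>
      wp (word_bits n) c0 (I n \<pi> 0) ((\<lambda>_. 0)(0 := int n)) \<and>
      (\<forall>k s. k < n \<longrightarrow> I n \<pi> k s \<longrightarrow> s 1 = f n (int (\<pi> ! k)) \<longrightarrow>
         wp (word_bits n) c1 (I n \<pi> (Suc k)) s) \<and>
      (\<forall>s. I n \<pi> n s \<longrightarrow> wp (word_bits n) c2 (\<lambda>u. contains_pattern \<pi> \<sigma> = (u 2 \<noteq> 0)) s)"
    and scratch: "\<And>n \<pi> k s t. \<pi> \<in> permutations_of_set {1..n} \<Longrightarrow> I n \<pi> k s \<Longrightarrow>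
      s 0 = int n \<and> ((\<forall>r. r \<notin> {1, 6} \<longrightarrow> t r = s r) \<longrightarrow> I n \<pi> k t)"
  shows "\<exists>A w ops. detects A \<sigma> w ops \<and>
      (\<lambda>n. real (space_bits A (w n))) \<in> O(\<lambda>n. ln (real n)) \<and>
      (\<lambda>n. real (ops n)) \<in> O(\<lambda>n. real n)"
proof (intro exI conjI)
  let ?A = "Stream_Alg c0 (Seq pre c1) c2"
  show "detects ?A \<sigma> word_bits
      (\<lambda>n. max_ops c0 + n * max_ops (Seq pre c1) + max_ops c2)"
  proof (rule detectsI, rule conjI)
    fix n :: nat and \<pi> :: "nat list"
  assume \<pi>: "\<pi> \<in> permutations_of_set {1..n}"
    show "fits (word_bits n) (int n)"
      by (rule fits_word_bits) (use powers_le[of "int n + 1"] in linarith)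
    have "wp (word_bits n) (Seq pre c1) (I n \<pi> (Suc k)) (s(1 := int (\<pi> ! k)))"
      if k: "k < n" and I: "I n \<pi> k s" for k s
      unfolding wp.simps(5)
    proof (rule wp_pre)
      have "set \<pi> = {1..n}" "length \<pi> = n"
        using \<pi> by (auto dest: permutations_of_setD simp: length_finite_permutations_of_set)
      then have "\<pi> ! k \<in> {1..n}"
        using k nth_mem[of k \<pi>] by simp
      then show "1 \<le> (s(1 := int (\<pi> ! k))) 1" "(s(1 := int (\<pi> ! k))) 1 \<le> int n"
        by auto
      show "(s(1 := int (\<pi> ! k))) 0 = int n"
        using scratch[OF \<pi> I] by simp
      fix t
      assume "t 1 = f n ((s(1 := int (\<pi> ! k))) 1)"
        and "\<And>r. r \<notin> {1, 6} \<Longrightarrow> t r = (s(1 := int (\<pi> ! k))) r"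
      moreover from this have "I n \<pi> k t"
        using scratch[OF \<pi> I, of t] by auto
      ultimately show "wp (word_bits n) c1 (I n \<pi> (Suc k)) t"
        using run[OF \<pi>] k by auto
    qed
    then show "\<exists>J. wp (word_bits n) c0 (J 0) ((\<lambda>_. 0)(0 := int n)) \<and>
        (\<forall>k s. k < n \<longrightarrow> J k s \<longrightarrow> wp (word_bits n) (Seq pre c1) (J (Suc k)) (s(1 := int (\<pi> ! k)))) \<and>
        (\<forall>s. J n s \<longrightarrow> wp (word_bits n) c2 (\<lambda>u. contains_pattern \<pi> \<sigma> = (u 2 \<noteq> 0)) s)"
      using run[OF \<pi>] by (intro exI[of _ "I n \<pi>"]) blast
  qed
  show "(\<lambda>n. real (space_bits ?A (word_bits n))) \<in> O(\<lambda>n. ln (real n))"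
    unfolding space_bits_def by (rule word_bits_bigo)
  show "(\<lambda>n. real (max_ops c0 + n * max_ops (Seq pre c1) + max_ops c2)) \<in> O(\<lambda>n. real n)"
    unfolding of_nat_add of_nat_mult by real_asymp
qed

lemma detects_312:
  assumes "\<And>n \<pi>. contains_pattern \<pi> \<sigma> \<longleftrightarrow> has_312 (map (\<lambda>v. f n (int v)) \<pi>)"
  shows "\<exists>A w ops. detects A \<sigma> w ops \<and>
      (\<lambda>n. real (space_bits A (w n))) \<in> O(\<lambda>n. ln (real n)) \<and>
      (\<lambda>n. real (ops n)) \<in> O(\<lambda>n. real n)"
proof (rule detects_invariant)
  fix n :: nat and \<pi> :: "nat list"
  assume \<pi>: "\<pi> \<in> permutations_of_set {1..n}"
  let ?xs = "map (\<lambda>v. f n (int v)) \<pi>"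
  let ?I = "stream_permutation.inv_312 ?xs n (int n + 1)"
  interpret stream_permutation ?xs n "int n + 1"
    by (rule stream_permutation[OF \<pi>])
  have "?I 0 ((\<lambda>_. 0)(0 := int n))"
    unfolding inv_312_def common_def by simp
  moreover have "wp (word_bits n) update_312 (?I (Suc k)) s"
    if "k < n" "?I k s" "s 1 = f n (int (\<pi> ! k))" for k s
    using that len by (intro wp_update_312) auto
  moreover have "contains_pattern \<pi> \<sigma> = (s 2 \<noteq> 0)" if "?I n s" for s
    using inv_312_output[OF that] assms[of \<pi> n] by simp
  ultimately show "wp (word_bits n) Skip (?I 0) ((\<lambda>_. 0)(0 := int n)) \<and>
      (\<forall>k s. k < n \<longrightarrow> ?I k s \<longrightarrow> s 1 = f n (int (\<pi> ! k)) \<longrightarrow>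
         wp (word_bits n) update_312 (?I (Suc k)) s) \<and>
      (\<forall>s. ?I n s \<longrightarrow> wp (word_bits n) Skip (\<lambda>u. contains_pattern \<pi> \<sigma> = (u 2 \<noteq> 0)) s)"
    by simp
  show "s 0 = int n \<and> ((\<forall>r. r \<notin> {1, 6} \<longrightarrow> t r = s r) \<longrightarrow> ?I k t)" if "?I k s" for k s t
    using that inv_scratch(1)[OF _ that, of t] unfolding inv_312_def common_def by blast
qed

lemma detects_231:
  assumes "\<And>n \<pi>. contains_pattern \<pi> \<sigma> \<longleftrightarrow> has_231 (map (\<lambda>v. f n (int v)) \<pi>)"
  shows "\<exists>A w ops. detects A \<sigma> w ops \<and>
      (\<lambda>n. real (space_bits A (w n))) \<in> O(\<lambda>n. ln (real n)) \<and>
      (\<lambda>n. real (ops n)) \<in> O(\<lambda>n. real n)"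
proof (rule detects_invariant)
  fix n :: nat and \<pi> :: "nat list"
  assume \<pi>: "\<pi> \<in> permutations_of_set {1..n}"
  let ?xs = "map (\<lambda>v. f n (int v)) \<pi>"
  let ?I = "stream_permutation.inv_231 ?xs n (int n + 1)"
  interpret stream_permutation ?xs n "int n + 1"
    by (rule stream_permutation[OF \<pi>])
  have "wp (word_bits n) update_231 (?I (Suc k)) s"
    if "k < n" "?I k s" "s 1 = f n (int (\<pi> ! k))" for k s
    using that len by (intro wp_update_231) auto
  then show "wp (word_bits n) init_231 (?I 0) ((\<lambda>_. 0)(0 := int n)) \<and>
      (\<forall>k s. k < n \<longrightarrow> ?I k s \<longrightarrow> s 1 = f n (int (\<pi> ! k)) \<longrightarrow>
         wp (word_bits n) update_231 (?I (Suc k)) s) \<and>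
      (\<forall>s. ?I n s \<longrightarrow> wp (word_bits n) output_231 (\<lambda>u. contains_pattern \<pi> \<sigma> = (u 2 \<noteq> 0)) s)"
    using wp_init_231 wp_output_231 assms[of \<pi> n] by simp
  show "s 0 = int n \<and> ((\<forall>r. r \<notin> {1, 6} \<longrightarrow> t r = s r) \<longrightarrow> ?I k t)" if "?I k s" for k s t
    using that inv_scratch(2)[OF _ that, of t] unfolding inv_231_def common_def by blast
qed

end

interpretation identity: input_map Skip "\<lambda>n x. x"
  by standard (auto simp: bij_betw_def)

interpretation complement: input_map complement_code "\<lambda>n x. int n + 1 - x"
proof
  show "bij_betw (\<lambda>x. int n + 1 - x) {1..int n} {1..int n}" for n
    by (rule bij_betw_byWitness[where f' = "\<lambda>x. int n + 1 - x"]) auto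
  show "wp (word_bits n) complement_code Q s"
    if "1 \<le> s 1" "s 1 \<le> int n" "s 0 = int n"
      "\<And>t. t 1 = int n + 1 - s 1 \<Longrightarrow> (\<And>r. r \<notin> {1, 6} \<Longrightarrow> t r = s r) \<Longrightarrow> Q t" for n Q s
  proof -
    have "fits (word_bits n) (int n + 1)" "fits (word_bits n) (int n + 1 - s 1)"
      by (rule fits_word_bits; use powers_le[of "int n + 1"] that(1-3) in linarith)+
    then show ?thesis
      unfolding complement_code_def using that by simp
  qed
qed

theorem corollary5p6:
  fixes \<sigma> :: "nat list"
  assumes "\<sigma> \<in> {[1, 3, 2], [2, 1, 3], [2, 3, 1], [3, 1, 2]}"
  shows "\<exists>(A :: stream_alg) (w :: nat \<Rightarrow> nat) (ops :: nat \<Rightarrow> nat).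
           detects A \<sigma> w ops \<and>
           (\<lambda>n. real (space_bits A (w n))) \<in> O(\<lambda>n. ln (real n)) \<and>
           (\<lambda>n. real (ops n)) \<in> O(\<lambda>n. real n)"
proof -
  from assms consider "\<sigma> = [1, 3, 2]" | "\<sigma> = [2, 1, 3]" | "\<sigma> = [2, 3, 1]" | "\<sigma> = [3, 1, 2]"
    by auto
  then show ?thesis
  proof cases
    case 1
    show ?thesis
      unfolding 1 by (rule complement.detects_312) (rule contains_132_iff)
  next
    case 2
    show ?thesis
      unfolding 2 by (rule complement.detects_231) (rule contains_213_iff)
  next
    case 3
    show ?thesis
      unfolding 3 by (rule identity.detects_231) (rule contains_231_iff)
  next
    case 4
    show ?thesis
      unfolding 4 by (rule identity.detects_312) (rule contains_312_iff)
  qed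
qed

end
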